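(* Let $G\subset \mathrm{GL}(n,\mathbb{R})$ be a Lie subgroup with Lie algebra $\mathfrak{g}$, let $\pi:P\to M$ be a $G$-structure on an $n$-dimensional manifold $M$ with tautological form $\theta$, and let $\mathfrak{k}$ be $\mathbb{R}^n$ equipped with an almost Lie bracket $[\cdot,\cdot]_{\mathfrak{k}}$. Then $P$ is $\mathfrak{g}\ltimes\mathfrak{k}$-flat (as a Cartan bundle) if and only if there exists a principal connection $\tau\in\Omega^1(P,\mathfrak{g})$ on $P$, with torsion function $T$ and curvature function $R$, such that (1) $R=0$ (i.e. $\tau$ is flat), and (2) $T=-[\cdot,\cdot]_{\mathfrak{k}}$ (i.e. the torsion function is constant, equal to minus the bracket on $\mathfrak{k}$).
   Context: A $G$-structure on $M$ is a reduction $P\subset\mathrm{Fr}(M)$ of the frame bundle to $G$; here $P$ is viewed as a principal bundle with right action, $\alpha^\dagger_p=\frac{d}{dt}|_{0}\,p\cdot\exp(t\alpha)$, and $G$-equivariance of a form $\beta$ with values in a $G$-representation means $R_g^*\beta=g^{-1}\cdot\beta$. The tautological form $\theta\in\Omega^1(P,\mathbb{R}^n)$ is defined by letting $\theta_p(v)$ be the components of $d\pi(v)$ in the frame $p$. As a Cartan bundle, $(P,\theta)$ has $\mathfrak{h}=\mathfrak{g}$ and $V=\mathbb{R}^n$ with the standard $G$-representation. An almost Lie bracket is a bilinear skew-symmetric bracket (Jacobi not required). $\mathfrak{g}\ltimes\mathfrak{k}$ is the vector space $\mathfrak{g}\times\mathbb{R}^n$ with the $G$-representation (adjoint)$\times$(standard)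 and the almost Lie bracket $[(\alpha,v),(\beta,w)]=([\alpha,\beta]_{\mathfrak{g}},[v,w]_{\mathfrak{k}}+\alpha(w)-\beta(v))$, where $\alpha(w)$ is the matrix action. A $\mathfrak{g}\ltimes\mathfrak{k}$-lift of $\theta$ is a $G$-equivariant form $\eta\in\Omega^1(P,\mathfrak{g}\times\mathbb{R}^n)$ with $\eta(\alpha^\dagger)=(\alpha,0)$ for all $\alpha\in\mathfrak{g}$ and $\mathrm{pr}_{\mathbb{R}^n}\circ\eta=\theta$. $P$ is called $\mathfrak{g}\ltimes\mathfrak{k}$-flat if there is such a lift $\eta$ with $d\eta+\frac12[\eta,\eta]=0$, where $[\eta,\eta](v,w)=2[\eta(v),\eta(w)]$ is computed with the bracket of $\mathfrak{g}\ltimes\mathfrak{k}$. A principal connection is a $G$-equivariant $\tau\in\Omega^1(P,\mathfrak{g})$ with $\tau(\alpha^\dagger)=\alpha$. Its torsion function $T:P\to\mathrm{Hom}(\wedge^2\mathbb{R}^n,\mathbb{R}^n)$ and curvature function $R:P\to\mathrm{Hom}(\wedge^2\mathbb{R}^n,\mathfrak{g})$ are defined by the Cartan structure equations $d\theta=T(\theta\wedge\theta)-\tau\wedge\theta$, $d\tau=R(\theta\wedge\theta)-\tau\wedge\tau$, where $T(\theta\wedge\theta)(v,w)=T(\theta(v),\theta(w))$, $R(\theta\wedge\theta)(v,w)=R(\theta(v),\theta(w))$, $(\tau\wedge\theta)(v,w)=\tau(v)(\theta(w))-\tau(w)(\theta(v))$, and $(\tau\wedge\tau)(v,w)=[\tau(v),\tau(w)]_{\mathfrak{g}}$.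 *)

theory Defs
  imports "HOL-Analysis.Analysis"
begin

section \<open>Smooth maps on open subsets of a linear subspace\<close>

text \<open>
  Manifolds are modelled on a linear subspace \<open>E\<close> of a Euclidean space. The class
  \<^class>\<open>euclidean_space\<close> has no 0-dimensional instance, and discrete groups (so in particular
  \<open>{e}\<close>-structures) have to be covered. In \<open>Ck_on k E S f\<close> the set \<open>S\<close> is
  meant to be relatively open in \<open>E\<close>; then \<open>f' x\<close> is unique on \<open>E\<close>, and only its values on \<open>E\<close>
  are used.
\<close>

primrec Ck_on ::
  "nat \<Rightarrow> 'a::euclidean_space set \<Rightarrow> 'a set \<Rightarrow> ('a \<Rightarrow> 'b::real_normed_vector) \<Rightarrow> bool" where
  "Ck_on 0 E S f \<longleftrightarrow> continuous_on S f"
| "Ck_on (Suc k) E S f \<longleftrightarrow>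
     (\<exists>f'. (\<forall>x\<in>S. (f has_derivative f' x) (at x within S)) \<and>
           (\<forall>v\<in>E. Ck_on k E S (\<lambda>x. f' x v)))"

definition smooth_on :: "'a::euclidean_space set \<Rightarrow> 'a set \<Rightarrow> ('a \<Rightarrow> 'b::real_normed_vector) \<Rightarrow> bool"
  where "smooth_on E S f \<longleftrightarrow> (\<forall>k. Ck_on k E S f)"

text \<open>The derivative \<open>Df\<^sub>x(v)\<close>; for smooth \<open>f\<close> it is linear in \<open>v \<in> E\<close>.\<close>

definition dir_deriv :: "('a::real_normed_vector \<Rightarrow> 'b::real_normed_vector) \<Rightarrow> 'a \<Rightarrow> 'a \<Rightarrow> 'b"
  where "dir_deriv f x v = vector_derivative (\<lambda>t. f (x + t *\<^sub>R v)) (at 0)"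


section \<open>Smooth manifolds\<close>

type_synonym ('m, 'e) chart = "'m set \<times> ('m \<Rightarrow> 'e)"

record ('m, 'e) mfd =
  pts :: "'m set"
  model :: "'e set"
  atlas :: "('m, 'e) chart set"

abbreviation cinv :: "('m, 'e) chart \<Rightarrow> 'e \<Rightarrow> 'm"
  where "cinv c \<equiv> inv_into (fst c) (snd c)"

definition smooth_atlas :: "('m, 'e::euclidean_space) mfd \<Rightarrow> bool" where
  "smooth_atlas M \<longleftrightarrow>
     subspace (model M) \<and>
     (\<Union>c\<in>atlas M. fst c) = pts M \<and>
     (\<forall>c\<in>atlas M. inj_on (snd c) (fst c) \<and>
        openin (top_of_set (model M)) (snd c ` fst c)) \<and>
     (\<forall>c\<in>atlas M. \<forall>c'\<in>atlas M.
        openin (top_of_set (model M)) (snd c ` (fst c \<inter> fst c')) \<and>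
        smooth_on (model M) (snd c ` (fst c \<inter> fst c')) (snd c' \<circ> cinv c))"

definition mfd_open :: "('m, 'e::euclidean_space) mfd \<Rightarrow> 'm set \<Rightarrow> bool" where
  "mfd_open M W \<longleftrightarrow> W \<subseteq> pts M \<and>
     (\<forall>c\<in>atlas M. openin (top_of_set (model M)) (snd c ` (W \<inter> fst c)))"

definition mfd_topology :: "('m, 'e::euclidean_space) mfd \<Rightarrow> 'm topology"
  where "mfd_topology M = topology (mfd_open M)"

lemma openin_mfd_topology:
  assumes "smooth_atlas M"
  shows "openin (mfd_topology M) = mfd_open M"
proof -
  have "istopology (mfd_open M)"
    unfolding istopology_def
  proof (intro conjI allI impI)
    fix S T assume S: "mfd_open M S" and T: "mfd_open M T"
    have "openin (top_of_set (model M)) (snd c ` (S \<inter> T \<inter> fst c))" if c: "c \<in> atlas M" for c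
    proof -
      have inj: "inj_on (snd c) (fst c)"
        using assms c by (auto simp: smooth_atlas_def)
      have "snd c ` (S \<inter> T \<inter> fst c) = snd c ` (S \<inter> fst c) \<inter> snd c ` (T \<inter> fst c)"
        using inj by (auto simp: inj_on_def image_iff)
      then show ?thesis
        using S T c by (auto simp: mfd_open_def)
    qed
    then show "mfd_open M (S \<inter> T)"
      using S by (auto simp: mfd_open_def)
  next
    fix K assume K: "\<forall>S\<in>K. mfd_open M S"
    have "openin (top_of_set (model M)) (snd c ` (\<Union>K \<inter> fst c))" if c: "c \<in> atlas M" for c
    proof -
      have "snd c ` (\<Union>K \<inter> fst c) = (\<Union>S\<in>K. snd c ` (S \<inter> fst c))"
        by auto
      then show ?thesis
        using K c by (auto simp: mfd_open_def)
    qed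
    then show "mfd_open M (\<Union>K)"
      using K by (auto simp: mfd_open_def)
  qed
  then show ?thesis
    by (simp add: mfd_topology_def topology_inverse')
qed

definition smooth_manifold :: "('m, 'e::euclidean_space) mfd \<Rightarrow> bool" where
  "smooth_manifold M \<longleftrightarrow> smooth_atlas M \<and>
     Hausdorff_space (mfd_topology M) \<and> second_countable (mfd_topology M)"

definition smooth_map ::
  "('m, 'e::euclidean_space) mfd \<Rightarrow> ('n, 'f::euclidean_space) mfd \<Rightarrow> ('m \<Rightarrow> 'n) \<Rightarrow> bool" where
  "smooth_map M N f \<longleftrightarrow> f ` pts M \<subseteq> pts N \<and>
     (\<forall>c\<in>atlas M. \<forall>c'\<in>atlas N.
        openin (top_of_set (model M)) (snd c ` (fst c \<inter> f -` fst c')) \<and>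
        smooth_on (model M) (snd c ` (fst c \<inter> f -` fst c')) (snd c' \<circ> f \<circ> cinv c))"

definition diffeomorphism ::
  "('m, 'e::euclidean_space) mfd \<Rightarrow> ('n, 'f::euclidean_space) mfd \<Rightarrow> ('m \<Rightarrow> 'n) \<Rightarrow> bool" where
  "diffeomorphism M N f \<longleftrightarrow> bij_betw f (pts M) (pts N) \<and>
     smooth_map M N f \<and> smooth_map N M (inv_into (pts M) f)"

definition euclidean_mfd :: "('e, 'e::euclidean_space) mfd"
  where "euclidean_mfd = \<lparr>pts = UNIV, model = UNIV, atlas = {(UNIV, id)}\<rparr>"

definition open_submfd :: "('m, 'e) mfd \<Rightarrow> 'm set \<Rightarrow> ('m, 'e) mfd" where
  "open_submfd M W =
     \<lparr>pts = pts M \<inter> W, model = model M, atlas = (\<lambda>c. (fst c \<inter> W, snd c)) ` atlas M\<rparr>"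

definition prod_mfd :: "('m, 'e) mfd \<Rightarrow> ('n, 'f) mfd \<Rightarrow> ('m \<times> 'n, 'e \<times> 'f) mfd" where
  "prod_mfd M N =
     \<lparr>pts = pts M \<times> pts N, model = model M \<times> model N,
      atlas = {(fst c \<times> fst d, map_prod (snd c) (snd d)) | c d. c \<in> atlas M \<and> d \<in> atlas N}\<rparr>"


section \<open>Tangent vectors\<close>

text \<open>
  A tangent vector at \<open>p\<close> is the family of its coordinate vectors in all charts around \<open>p\<close>,
  related by the derivatives of the coordinate changes. The components in charts not
  containing \<open>p\<close> are set to 0, so that equality of tangent vectors at \<open>p\<close> is equality of
  functions.
\<close>

type_synonym ('m, 'e) tangent = "('m, 'e) chart \<Rightarrow> 'e"

definition tangent_space :: "('m, 'e::euclidean_space) mfd \<Rightarrow> 'm \<Rightarrow> ('m, 'e) tangent set" where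
  "tangent_space M p = {v.
     (\<forall>c. \<not> (c \<in> atlas M \<and> p \<in> fst c) \<longrightarrow> v c = 0) \<and>
     (\<forall>c\<in>atlas M. p \<in> fst c \<longrightarrow> v c \<in> model M) \<and>
     (\<forall>c\<in>atlas M. \<forall>c'\<in>atlas M. p \<in> fst c \<longrightarrow> p \<in> fst c' \<longrightarrow>
        v c' = dir_deriv (snd c' \<circ> cinv c) (snd c p) (v c))}"

definition tangent_add ::
    "('m, 'e::real_vector) tangent \<Rightarrow> ('m, 'e) tangent \<Rightarrow> ('m, 'e) tangent"
  where "tangent_add v w = (\<lambda>c. v c + w c)"

definition tangent_scale :: "real \<Rightarrow> ('m, 'e::real_vector) tangent \<Rightarrow> ('m, 'e) tangent"
  where "tangent_scale a v = (\<lambda>c. a *\<^sub>R v c)"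

text \<open>The tangent vector at \<open>p\<close> with component \<open>e\<close> in the chart \<open>c\<close>.\<close>

definition tangent_of ::
  "('m, 'e::euclidean_space) mfd \<Rightarrow> ('m, 'e) chart \<Rightarrow> 'm \<Rightarrow> 'e \<Rightarrow> ('m, 'e) tangent" where
  "tangent_of M c p e =
     (\<lambda>c'. if c' \<in> atlas M \<and> p \<in> fst c' then dir_deriv (snd c' \<circ> cinv c) (snd c p) e else 0)"

definition chart_at :: "('m, 'e) mfd \<Rightarrow> 'm \<Rightarrow> ('m, 'e) chart"
  where "chart_at M p = (SOME c. c \<in> atlas M \<and> p \<in> fst c)"

text \<open>For smooth \<open>f\<close> the result does not depend on the chart used at \<open>p\<close>.\<close>

definition tangent_map ::
  "('m, 'e::euclidean_space) mfd \<Rightarrow> ('n, 'f::euclidean_space) mfd \<Rightarrow> ('m \<Rightarrow> 'n) \<Rightarrow> 'm \<Rightarrow>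
     ('m, 'e) tangent \<Rightarrow> ('n, 'f) tangent" where
  "tangent_map M N f p v =
     (let c = chart_at M p in
      (\<lambda>c'. if c' \<in> atlas N \<and> f p \<in> fst c'
            then dir_deriv (snd c' \<circ> f \<circ> cinv c) (snd c p) (v c) else 0))"

definition velocity ::
  "('m, 'e::euclidean_space) mfd \<Rightarrow> (real \<Rightarrow> 'm) \<Rightarrow> real \<Rightarrow> ('m, 'e) tangent" where
  "velocity M \<gamma> t =
     (\<lambda>c. if c \<in> atlas M \<and> \<gamma> t \<in> fst c then vector_derivative (snd c \<circ> \<gamma>) (at t) else 0)"

definition immersion ::
  "('m, 'e::euclidean_space) mfd \<Rightarrow> ('n, 'f::euclidean_space) mfd \<Rightarrow> ('m \<Rightarrow> 'n) \<Rightarrow> bool" where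
  "immersion M N f \<longleftrightarrow> smooth_map M N f \<and>
     (\<forall>p\<in>pts M. inj_on (tangent_map M N f p) (tangent_space M p))"


section \<open>Differential forms\<close>

type_synonym ('m, 'e, 'w) form1 = "'m \<Rightarrow> ('m, 'e) tangent \<Rightarrow> 'w"
type_synonym ('m, 'e, 'w) form2 = "'m \<Rightarrow> ('m, 'e) tangent \<Rightarrow> ('m, 'e) tangent \<Rightarrow> 'w"

text \<open>The coordinate expression \<open>x \<mapsto> \<omega>\<^sub>x(e)\<close> of a 1-form in a chart.\<close>

definition form1_in_chart ::
  "('m, 'e::euclidean_space) mfd \<Rightarrow> ('m, 'e) chart \<Rightarrow> ('m, 'e, 'w) form1 \<Rightarrow> 'e \<Rightarrow> 'e \<Rightarrow> 'w" where
  "form1_in_chart M c \<omega> x e = \<omega> (cinv c x) (tangent_of M c (cinv c x) e)"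

text \<open>
  \<open>Forms1 M W\<close> is \<open>\<Omega>\<^sup>1(M, W)\<close> for a linear subspace \<open>W\<close> of the target type. Values of a form at
  points outside \<open>M\<close> or on functions that are not tangent vectors are irrelevant throughout.
\<close>

definition Forms1 ::
  "('m, 'e::euclidean_space) mfd \<Rightarrow> 'w::euclidean_space set \<Rightarrow> ('m, 'e, 'w) form1 set" where
  "Forms1 M W = {\<omega>.
     (\<forall>p\<in>pts M. \<forall>v\<in>tangent_space M p. \<omega> p v \<in> W) \<and>
     (\<forall>p\<in>pts M. \<forall>v\<in>tangent_space M p. \<forall>w\<in>tangent_space M p.
        \<omega> p (tangent_add v w) = \<omega> p v + \<omega> p w) \<and>
     (\<forall>p\<in>pts M. \<forall>a. \<forall>v\<in>tangent_space M p. \<omega> p (tangent_scale a v) = a *\<^sub>R \<omega> p v) \<and>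
     (\<forall>c\<in>atlas M. \<forall>e\<in>model M.
        smooth_on (model M) (snd c ` fst c) (\<lambda>x. form1_in_chart M c \<omega> x e))}"

text \<open>
  The convention is \<open>d\<omega>(X, Y) = X(\<omega>(Y)) - Y(\<omega>(X)) - \<omega>([X, Y])\<close>, evaluated on coordinate vector
  fields of a chart (the result does not depend on the chart).
\<close>

definition ext_deriv ::
  "('m, 'e::euclidean_space) mfd \<Rightarrow> ('m, 'e, 'w::euclidean_space) form1 \<Rightarrow> ('m, 'e, 'w) form2" where
  "ext_deriv M \<omega> p v w =
     (let c = chart_at M p in
        dir_deriv (\<lambda>x. form1_in_chart M c \<omega> x (w c)) (snd c p) (v c)
      - dir_deriv (\<lambda>x. form1_in_chart M c \<omega> x (v c)) (snd c p) (w c))"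


section \<open>Lie subgroups of the general linear group\<close>

definition GL_mfd :: "(real^'n^'n, real^'n^'n) mfd"
  where "GL_mfd = open_submfd euclidean_mfd {A. invertible A}"

text \<open>Lie subgroups are immersed, not necessarily closed.\<close>

definition lie_subgroup_GL :: "(real^'n^'n, 'k::euclidean_space) mfd \<Rightarrow> bool" where
  "lie_subgroup_GL G \<longleftrightarrow>
     smooth_manifold G \<and>
     mat 1 \<in> pts G \<and>
     (\<forall>a\<in>pts G. \<forall>b\<in>pts G. a ** b \<in> pts G) \<and>
     (\<forall>a\<in>pts G. invertible a \<and> matrix_inv a \<in> pts G) \<and>
     smooth_map (prod_mfd G G) G (\<lambda>(a, b). a ** b) \<and>
     smooth_map G G matrix_inv \<and>
     immersion G GL_mfd (\<lambda>a. a)"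

text \<open>
  The Lie algebra as a space of matrices: the image of the tangent space at the identity under
  the derivative of the inclusion, read off in the only chart of \<^const>\<open>GL_mfd\<close>.
\<close>

definition lie_algebra :: "(real^'n^'n, 'k::euclidean_space) mfd \<Rightarrow> (real^'n^'n) set" where
  "lie_algebra G =
     (\<lambda>v. tangent_map G GL_mfd (\<lambda>a. a) (mat 1) v ({A. invertible A}, id)) `
       tangent_space G (mat 1)"

text \<open>
  The function \<^const>\<open>exp\<close> is not available for matrices, since multiplication on the type of
  vectors is componentwise.
\<close>

definition mexp :: "real^'n^'n \<Rightarrow> real^'n^'n"
  where "mexp A = (\<Sum>k. (1 / fact k) *\<^sub>R (((**) A ^^ k) (mat 1)))"

definition mbracket :: "real^'n^'n \<Rightarrow> real^'n^'n \<Rightarrow> real^'n^'n"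
  where "mbracket A B = A ** B - B ** A"


section \<open>The frame bundle and G-structures\<close>

text \<open>A frame at \<open>x\<close> is a linear isomorphism \<open>u\<close> from \<open>\<real>\<^sup>n\<close> to the tangent space at \<open>x\<close>.\<close>

type_synonym ('m, 'n) frame = "'m \<times> (real^'n \<Rightarrow> ('m, real^'n) tangent)"

definition frames :: "('m, real^'n) mfd \<Rightarrow> ('m, 'n) frame set" where
  "frames M = {(x, u). x \<in> pts M \<and>
     (\<forall>v w. u (v + w) = tangent_add (u v) (u w)) \<and>
     (\<forall>a v. u (a *\<^sub>R v) = tangent_scale a (u v)) \<and>
     bij_betw u UNIV (tangent_space M x)}"

text \<open>
  A chart of the base induces the chart of the frame bundle sending a frame to the coordinates
  of its base point and the matrix of its components.
\<close>

definition frame_chart ::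
  "('m, real^'n) mfd \<Rightarrow> ('m, real^'n) chart \<Rightarrow> (('m, 'n) frame, (real^'n) \<times> (real^'n^'n)) chart" where
  "frame_chart M c =
     ({f \<in> frames M. fst f \<in> fst c}, \<lambda>f. (snd c (fst f), matrix (\<lambda>w. snd f w c)))"

definition frame_bundle ::
  "('m, real^'n) mfd \<Rightarrow> (('m, 'n) frame, (real^'n) \<times> (real^'n^'n)) mfd" where
  "frame_bundle M = \<lparr>pts = frames M, model = UNIV, atlas = frame_chart M ` atlas M\<rparr>"

definition frame_act :: "('m, 'n) frame \<Rightarrow> real^'n^'n \<Rightarrow> ('m, 'n) frame"
  where "frame_act f g = (fst f, \<lambda>w. snd f (g *v w))"

definition principal_bundle ::
  "(real^'n^'n, 'k::euclidean_space) mfd \<Rightarrow> ('p, 'e::euclidean_space) mfd \<Rightarrow>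
     ('m, 'b::euclidean_space) mfd \<Rightarrow> ('p \<Rightarrow> 'm) \<Rightarrow> ('p \<Rightarrow> real^'n^'n \<Rightarrow> 'p) \<Rightarrow> bool" where
  "principal_bundle G P M \<pi> act \<longleftrightarrow>
     smooth_manifold P \<and>
     smooth_map P M \<pi> \<and>
     smooth_map (prod_mfd P G) P (\<lambda>(p, g). act p g) \<and>
     (\<forall>p\<in>pts P. \<forall>g\<in>pts G. \<pi> (act p g) = \<pi> p) \<and>
     (\<forall>p\<in>pts P. act p (mat 1) = p) \<and>
     (\<forall>p\<in>pts P. \<forall>g\<in>pts G. \<forall>h\<in>pts G. act (act p g) h = act p (g ** h)) \<and>
     (\<forall>x\<in>pts M. \<exists>U \<psi>. mfd_open M U \<and> x \<in> U \<and>
        diffeomorphism (open_submfd P (\<pi> -` U)) (prod_mfd (open_submfd M U) G) \<psi> \<and>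
        (\<forall>p\<in>pts P \<inter> \<pi> -` U. fst (\<psi> p) = \<pi> p \<and>
           (\<forall>g\<in>pts G. \<psi> (act p g) = (\<pi> p, snd (\<psi> p) ** g))))"

text \<open>
  The smooth structure of a reduction \<open>P\<close> is part of the data. With the first condition,
  smoothness of the inclusion makes it an equivariant injective immersion over \<open>M\<close>.
\<close>

definition G_structure ::
  "(real^'n^'n, 'k::euclidean_space) mfd \<Rightarrow> ('m, real^'n) mfd \<Rightarrow>
     (('m, 'n) frame, 'e::euclidean_space) mfd \<Rightarrow> bool" where
  "G_structure G M P \<longleftrightarrow>
     principal_bundle G P M fst frame_act \<and>
     pts P \<subseteq> frames M \<and>
     smooth_map P (frame_bundle M) (\<lambda>f. f)"

definition tautological_form ::
  "('m, real^'n) mfd \<Rightarrow> (('m, 'n) frame, 'e::euclidean_space) mfd \<Rightarrow>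
     (('m, 'n) frame, 'e, real^'n) form1" where
  "tautological_form M P p v = inv_into UNIV (snd p) (tangent_map P M fst p v)"

text \<open>\<open>\<alpha>\<^sup>\<dagger>\<^sub>p = d/dt p \<cdot> exp(t\<alpha>)\<close> at \<open>t = 0\<close>\<close>

definition fundamental_vector ::
  "(('m, 'n) frame, 'e::euclidean_space) mfd \<Rightarrow> real^'n^'n \<Rightarrow> ('m, 'n) frame \<Rightarrow>
     (('m, 'n) frame, 'e) tangent" where
  "fundamental_vector P \<alpha> p = velocity P (\<lambda>t. frame_act p (mexp (t *\<^sub>R \<alpha>))) 0"

text \<open>\<open>R\<^sub>g\<^sup>*\<beta> = g\<^sup>-\<^sup>1 \<cdot> \<beta>\<close>, where \<open>\<rho>\<close> is the action of \<open>G\<close> on the space of values.\<close>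

definition equivariant_form ::
  "(real^'n^'n, 'k::euclidean_space) mfd \<Rightarrow> (('m, 'n) frame, 'e::euclidean_space) mfd \<Rightarrow>
     (real^'n^'n \<Rightarrow> 'w \<Rightarrow> 'w) \<Rightarrow> (('m, 'n) frame, 'e, 'w) form1 \<Rightarrow> bool" where
  "equivariant_form G P \<rho> \<beta> \<longleftrightarrow>
     (\<forall>g\<in>pts G. \<forall>p\<in>pts P. \<forall>v\<in>tangent_space P p.
        \<beta> (frame_act p g) (tangent_map P P (\<lambda>q. frame_act q g) p v) = \<rho> (matrix_inv g) (\<beta> p v))"

definition Ad :: "real^'n^'n \<Rightarrow> real^'n^'n \<Rightarrow> real^'n^'n"
  where "Ad g A = g ** A ** matrix_inv g"


section \<open>The almost Lie algebra and flatness\<close>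

definition almost_lie_bracket :: "(real^'n \<Rightarrow> real^'n \<Rightarrow> real^'n) \<Rightarrow> bool"
  where "almost_lie_bracket b \<longleftrightarrow> bilinear b \<and> (\<forall>v w. b v w = - b w v)"

definition sdp_bracket ::
  "(real^'n \<Rightarrow> real^'n \<Rightarrow> real^'n) \<Rightarrow> (real^'n^'n) \<times> (real^'n) \<Rightarrow> (real^'n^'n) \<times> (real^'n) \<Rightarrow>
     (real^'n^'n) \<times> (real^'n)" where
  "sdp_bracket b = (\<lambda>(\<alpha>, v) (\<beta>, w). (mbracket \<alpha> \<beta>, b v w + \<alpha> *v w - \<beta> *v v))"

definition sdp_rep ::
  "real^'n^'n \<Rightarrow> (real^'n^'n) \<times> (real^'n) \<Rightarrow> (real^'n^'n) \<times> (real^'n)" where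
  "sdp_rep g = (\<lambda>(\<alpha>, v). (Ad g \<alpha>, g *v v))"

definition sdp_lift ::
  "(real^'n^'n, 'k::euclidean_space) mfd \<Rightarrow> ('m, real^'n) mfd \<Rightarrow>
     (('m, 'n) frame, 'e::euclidean_space) mfd \<Rightarrow>
     (('m, 'n) frame, 'e, (real^'n^'n) \<times> (real^'n)) form1 \<Rightarrow> bool" where
  "sdp_lift G M P \<eta> \<longleftrightarrow>
     \<eta> \<in> Forms1 P (lie_algebra G \<times> UNIV) \<and>
     equivariant_form G P sdp_rep \<eta> \<and>
     (\<forall>\<alpha>\<in>lie_algebra G. \<forall>p\<in>pts P. \<eta> p (fundamental_vector P \<alpha> p) = (\<alpha>, 0)) \<and>
     (\<forall>p\<in>pts P. \<forall>v\<in>tangent_space P p. snd (\<eta> p v) = tautological_form M P p v)"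

text \<open>The 2-form \<open>[\<eta>, \<eta>]\<close>, with the factor 2.\<close>

definition bracket_form ::
  "('w \<Rightarrow> 'w \<Rightarrow> 'w::real_vector) \<Rightarrow> ('p, 'e, 'w) form1 \<Rightarrow> ('p, 'e, 'w) form2"
  where "bracket_form b \<eta> p v w = 2 *\<^sub>R b (\<eta> p v) (\<eta> p w)"

definition sdp_flat ::
  "(real^'n^'n, 'k::euclidean_space) mfd \<Rightarrow> (real^'n \<Rightarrow> real^'n \<Rightarrow> real^'n) \<Rightarrow>
     ('m, real^'n) mfd \<Rightarrow> (('m, 'n) frame, 'e::euclidean_space) mfd \<Rightarrow> bool" where
  "sdp_flat G b M P \<longleftrightarrow>
     (\<exists>\<eta>. sdp_lift G M P \<eta> \<and>
        (\<forall>p\<in>pts P. \<forall>v\<in>tangent_space P p. \<forall>w\<in>tangent_space P p.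
           ext_deriv P \<eta> p v w + (1/2) *\<^sub>R bracket_form (sdp_bracket b) \<eta> p v w = 0))"


section \<open>Principal connections, torsion and curvature\<close>

definition principal_connection ::
  "(real^'n^'n, 'k::euclidean_space) mfd \<Rightarrow> (('m, 'n) frame, 'e::euclidean_space) mfd \<Rightarrow>
     (('m, 'n) frame, 'e, real^'n^'n) form1 \<Rightarrow> bool" where
  "principal_connection G P \<tau> \<longleftrightarrow>
     \<tau> \<in> Forms1 P (lie_algebra G) \<and>
     equivariant_form G P Ad \<tau> \<and>
     (\<forall>\<alpha>\<in>lie_algebra G. \<forall>p\<in>pts P. \<tau> p (fundamental_vector P \<alpha> p) = \<alpha>)"

text \<open>\<open>Hom(\<Lambda>\<^sup>2\<real>\<^sup>n, W)\<close> as alternating bilinear maps\<close>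

definition alternating_maps :: "'w::real_vector set \<Rightarrow> (real^'n \<Rightarrow> real^'n \<Rightarrow> 'w) set" where
  "alternating_maps W = {B. bilinear B \<and> (\<forall>v. B v v = 0) \<and> (\<forall>v w. B v w \<in> W)}"

text \<open>
  The torsion and curvature functions are characterised by the Cartan structure equations;
  since \<open>\<theta>\<close> is pointwise surjective, these determine them uniquely on \<open>P\<close>.
\<close>

definition torsion_function ::
  "('m, real^'n) mfd \<Rightarrow> (('m, 'n) frame, 'e::euclidean_space) mfd \<Rightarrow>
     (('m, 'n) frame, 'e, real^'n^'n) form1 \<Rightarrow>
     (('m, 'n) frame \<Rightarrow> real^'n \<Rightarrow> real^'n \<Rightarrow> real^'n) \<Rightarrow> bool" where
  "torsion_function M P \<tau> T \<longleftrightarrow>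
     (let \<theta> = tautological_form M P in
      (\<forall>p\<in>pts P. T p \<in> alternating_maps UNIV) \<and>
      (\<forall>p\<in>pts P. \<forall>v\<in>tangent_space P p. \<forall>w\<in>tangent_space P p.
         ext_deriv P \<theta> p v w =
           T p (\<theta> p v) (\<theta> p w) - (\<tau> p v *v \<theta> p w - \<tau> p w *v \<theta> p v)))"

definition curvature_function ::
  "(real^'n^'n, 'k::euclidean_space) mfd \<Rightarrow> ('m, real^'n) mfd \<Rightarrow>
     (('m, 'n) frame, 'e::euclidean_space) mfd \<Rightarrow>
     (('m, 'n) frame, 'e, real^'n^'n) form1 \<Rightarrow>
     (('m, 'n) frame \<Rightarrow> real^'n \<Rightarrow> real^'n \<Rightarrow> real^'n^'n) \<Rightarrow> bool" where
  "curvature_function G M P \<tau> R \<longleftrightarrow>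
     (let \<theta> = tautological_form M P in
      (\<forall>p\<in>pts P. R p \<in> alternating_maps (lie_algebra G)) \<and>
      (\<forall>p\<in>pts P. \<forall>v\<in>tangent_space P p. \<forall>w\<in>tangent_space P p.
         ext_deriv P \<tau> p v w = R p (\<theta> p v) (\<theta> p w) - mbracket (\<tau> p v) (\<tau> p w)))"

end

theory Submission
  imports Defs
begin

text \<open>
  A lift \<open>\<eta>\<close> is the same as a pair \<open>(\<tau>, \<theta>)\<close> with \<open>\<tau>\<close> a principal connection, and the two components of
  \<open>d\<eta> + [\<eta>, \<eta>] / 2 = 0\<close> are the structure equations with \<open>R = 0\<close> and \<open>T = - [_, _]\<close>. The substance lies in
  showing that \<open>(\<tau>, \<theta>)\<close> is a lift, that is, that \<open>\<theta>\<close> is a smooth equivariant form that vanishes on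
  fundamental vectors. The last point needs the curve \<open>p \<cdot> exp(t\<alpha>)\<close> to be differentiable in \<open>P\<close>, hence
  \<open>exp(t\<alpha>)\<close> to lie in the immersed subgroup \<open>G\<close> and to be differentiable for its own manifold structure.
  This follows from \<open>exp(t\<alpha>) = lim (1 + t\<alpha>/n + o(1/n))^n\<close>, taken along points of a chart of \<open>G\<close>.
\<close>

section \<open>Smooth maps on relatively open sets\<close>

text \<open>The subgroup \<open>G\<close> is only immersed, so convergence of matrices from
  \<open>G\<close> says nothing about convergence in the topology of \<open>G\<close> itself. The
  estimates for powers are therefore made in a chart at the identity, with an error bound that does
  not depend on n. Compactness then gives a limit in the chart, and continuity of the inclusion
  identifies it with the exponential. Tangent vectors are handled as velocities of curves, which
  reduces all work with tangent maps to the chain rule along a curve. In particular, a right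
  translation is studied through the curve (l(t), g) in the product of \<open>P\<close> and
  \<open>G\<close>, on which the smoothness of the action itself can be used. Smoothness of \<theta>
  comes from a linear system: in the coordinates of the frame bundle, the matrix of the frame times
  \<theta> is the derivative of the projection, and Cramer's rule solves for \<theta>.\<close>

lemma eventually_nhds_openin:
  assumes "openin (top_of_set E) S" "isCont q t0" "q t0 \<in> S" "\<forall>\<^sub>F t in nhds t0. q t \<in> E"
  shows "\<forall>\<^sub>F t in nhds t0. q t \<in> S"
proof -
  obtain T where T: "open T" "S = E \<inter> T"
    using assms(1) by (auto simp: openin_open)
  have "(q \<longlongrightarrow> q t0) (nhds t0)"
    using assms(2) by (simp add: isCont_def tendsto_at_iff_tendsto_nhds)
  then have "\<forall>\<^sub>F t in nhds t0. q t \<in> T"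
    using T assms(3) by (intro topological_tendstoD) auto
  then show ?thesis
    using assms(4) by eventually_elim (use T in auto)
qed

lemma eventually_line_openin:
  fixes E :: "'a::real_normed_vector set"
  assumes "subspace E" "openin (top_of_set E) S" "x \<in> S" "v \<in> E"
  shows "\<forall>\<^sub>F t in nhds 0. x + t *\<^sub>R v \<in> S"
proof (rule eventually_nhds_openin[OF assms(2)])
  have "x \<in> E"
    using assms(2,3) openin_imp_subset by blast
  then show "\<forall>\<^sub>F t in nhds 0. x + t *\<^sub>R v \<in> E"
    using assms by (intro always_eventually) (auto intro: subspace_add subspace_scale)
qed (use assms in auto)

text \<open>A relatively open subset of a proper subspace has empty interior, so \<open>f\<close> is
  differentiable only within \<open>S\<close>. A curve that stays in \<open>S\<close> near
  \<open>t0\<close> still gives an ordinary derivative of the composition.\<close>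

lemma has_vector_derivative_chain_eventually:
  assumes f: "(f has_derivative f') (at (q t0) within S)"
    and q: "(q has_vector_derivative \<xi>) (at t0)"
    and S: "\<forall>\<^sub>F t in nhds t0. q t \<in> S"
  shows "((f \<circ> q) has_vector_derivative f' \<xi>) (at t0)"
proof -
  obtain T where T: "open T" "t0 \<in> T" "\<And>t. t \<in> T \<Longrightarrow> q t \<in> S"
    using S unfolding eventually_nhds by blast
  have at: "at t0 within T = at t0"
    using at_within_open[OF T(2,1)] .
  have "(f has_derivative f') (at (q t0) within q ` T)"
    using f T by (auto intro: has_derivative_subset)
  from vector_derivative_diff_chain_within[OF _ this] q show ?thesis
    by (simp add: at)
qed

lemma has_vector_derivative_line: "((\<lambda>t. x + t *\<^sub>R v) has_vector_derivative v) (at t)"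
  by (auto intro!: derivative_eq_intros)

lemma has_vector_derivative_cong_nhds:
  assumes "(f has_vector_derivative D) (at t0)" "\<forall>\<^sub>F t in nhds t0. f t = g t"
  shows "(g has_vector_derivative D) (at t0)"
proof -
  obtain T where T: "open T" "t0 \<in> T" "\<And>t. t \<in> T \<Longrightarrow> f t = g t"
    using assms(2) unfolding eventually_nhds by blast
  show ?thesis
    using has_vector_derivative_transform_within_open[OF assms(1) T] by simp
qed

lemma vector_derivative_cong_nhds:
  assumes "\<forall>\<^sub>F t in nhds t0. f t = g t"
  shows "vector_derivative f (at t0) = vector_derivative g (at t0)"
proof -
  have "(f has_vector_derivative D) (at t0) \<longleftrightarrow> (g has_vector_derivative D) (at t0)" for D
    using has_vector_derivative_cong_nhds[of f D t0 g] has_vector_derivative_cong_nhds[of g D t0 f]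
      assms eventually_mono[OF assms, of "\<lambda>t. g t = f t"] by auto
  then show ?thesis
    by (simp add: vector_derivative_def)
qed

lemma has_vector_derivative_imp_quotient:
  fixes q :: "real \<Rightarrow> 'a::real_normed_vector"
  assumes "(q has_vector_derivative \<xi>) (at t0)"
  shows "((\<lambda>h. (q (t0 + h) - q t0) /\<^sub>R h) \<longlongrightarrow> \<xi>) (at 0)"
proof -
  have lim: "((\<lambda>h. norm (q (t0 + h) - q t0 - h *\<^sub>R \<xi>) / norm h) \<longlongrightarrow> 0) (at 0)"
    using assms by (simp add: has_vector_derivative_def has_derivative_at)
  have eq: "norm ((q (t0 + h) - q t0) /\<^sub>R h - \<xi>) = norm (q (t0 + h) - q t0 - h *\<^sub>R \<xi>) / norm h"
    if "h \<noteq> 0" for h :: real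
  proof -
    have "(q (t0 + h) - q t0) /\<^sub>R h - \<xi> = (q (t0 + h) - q t0 - h *\<^sub>R \<xi>) /\<^sub>R h"
      using that by (simp add: scaleR_diff_right)
    then show ?thesis by (simp add: divide_inverse mult.commute)
  qed
  have "((\<lambda>h. (q (t0 + h) - q t0) /\<^sub>R h - \<xi>) \<longlongrightarrow> 0) (at 0)"
    by (rule Lim_null_comparison[OF _ lim]) (auto simp: eventually_at_filter eq)
  then show ?thesis by (simp add: LIM_zero_iff)
qed

text \<open>The difference quotients lie in \<open>E\<close>, which is closed because it is
  finite-dimensional.\<close>

lemma has_vector_derivative_in_subspace:
  fixes q :: "real \<Rightarrow> 'a::euclidean_space"
  assumes E: "subspace E" and q: "(q has_vector_derivative \<xi>) (at 0)"
    and ev: "\<forall>\<^sub>F t in nhds 0. q t \<in> E"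
  shows "\<xi> \<in> E"
proof (rule Lim_in_closed_set)
  show "closed E" by (rule closed_subspace[OF E])
  show "((\<lambda>h. (q (0 + h) - q 0) /\<^sub>R h) \<longlongrightarrow> \<xi>) (at 0)"
    by (rule has_vector_derivative_imp_quotient[OF q])
  have "q 0 \<in> E" using eventually_nhds_x_imp_x[OF ev] .
  have "\<forall>\<^sub>F t in at 0. q t \<in> E"
    using ev by (simp add: eventually_at_filter eventually_mono)
  then show "\<forall>\<^sub>F h in at 0. (q (0 + h) - q 0) /\<^sub>R h \<in> E"
    by eventually_elim (use E \<open>q 0 \<in> E\<close> in \<open>auto intro: subspace_scale subspace_diff\<close>)
qed auto

lemma has_vector_derivative_dir_deriv:
  assumes "subspace E" "openin (top_of_set E) S" "x \<in> S" "v \<in> E"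
    and "(f has_derivative f') (at x within S)"
  shows "((\<lambda>t. f (x + t *\<^sub>R v)) has_vector_derivative f' v) (at 0)"
  using has_vector_derivative_chain_eventually[OF _ has_vector_derivative_line
      eventually_line_openin[OF assms(1-4)], of f f'] assms(5)
  by (simp add: o_def)

lemma dir_deriv_eq:
  assumes "subspace E" "openin (top_of_set E) S" "x \<in> S" "v \<in> E"
    and "(f has_derivative f') (at x within S)"
  shows "dir_deriv f x v = f' v"
  unfolding dir_deriv_def
  by (rule vector_derivative_at) (rule has_vector_derivative_dir_deriv[OF assms])

lemma dir_deriv_cong:
  assumes "subspace E" "openin (top_of_set E) S" "x \<in> S" "v \<in> E" "\<And>y. y \<in> S \<Longrightarrow> f y = g y"
  shows "dir_deriv f x v = dir_deriv g x v"
  unfolding dir_deriv_def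
  by (rule vector_derivative_cong_nhds, rule eventually_mono[OF eventually_line_openin[OF assms(1-4)]])
     (use assms in auto)

lemma dir_deriv_0 [simp]: "dir_deriv f x 0 = 0"
  by (simp add: dir_deriv_def)

text \<open>Near \<open>x\<close> the set \<open>U\<close> coincides with \<open>E\<close>, so the
  derivative within \<open>U\<close> already controls all points of \<open>S\<close> close to
  \<open>x\<close>.\<close>

lemma has_derivative_within_openin_mono:
  fixes f :: "'a::real_normed_vector \<Rightarrow> 'b::real_normed_vector"
  assumes "openin (top_of_set E) U" "x \<in> U" "S \<subseteq> E" "(f has_derivative f') (at x within U)"
  shows "(f has_derivative f') (at x within S)"
proof -
  obtain T where T: "open T" "U = E \<inter> T"
    using assms(1) by (auto simp: openin_open)
  have "(f has_derivative f') (at x within (S \<inter> T))"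
    using assms T by (auto intro: has_derivative_subset)
  moreover have "at x within (S \<inter> T) = at x within S"
    using T assms(2) by (intro at_within_nhd[of _ T]) auto
  ultimately show ?thesis by simp
qed

section \<open>Iterated differentiability and its locality\<close>

lemma Ck_on_cong:
  assumes "\<And>x. x \<in> S \<Longrightarrow> f x = g x"
  shows "Ck_on k E S f \<longleftrightarrow> Ck_on k E S g"
proof -
  have *: "Ck_on k E S f \<Longrightarrow> Ck_on k E S g" if "\<And>x. x \<in> S \<Longrightarrow> f x = g x"
    for f g :: "'a \<Rightarrow> 'b"
  proof (cases k)
    case 0
    then show "Ck_on k E S f \<Longrightarrow> Ck_on k E S g"
      using that by (simp add: continuous_on_cong[of S S f g])
  next
    case (Suc m)
    have "(f has_derivative D) (at x within S) \<Longrightarrow> (g has_derivative D) (at x within S)"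
      if "x \<in> S" for D x
      using \<open>x \<in> S\<close> \<open>\<And>x. x \<in> S \<Longrightarrow> f x = g x\<close>
      by (metis has_derivative_transform)
    then show "Ck_on k E S f \<Longrightarrow> Ck_on k E S g"
      unfolding Suc Ck_on.simps by blast
  qed
  show ?thesis
    using *[of f g] *[of g f] assms by auto
qed

text \<open>The witness \<open>f'\<close> in \<open>Ck_on\<close> is chosen separately for each set
  and is not determined off \<open>E\<close>. The directional derivatives are intrinsic, so they
  agree on overlapping sets; this makes the gluing in \<open>Ck_on_local\<close> possible.\<close>

lemma Ck_on_Suc_iff:
  assumes "subspace E" "openin (top_of_set E) S"
  shows "Ck_on (Suc k) E S f \<longleftrightarrow>
    (\<forall>x\<in>S. f differentiable (at x within S)) \<and> (\<forall>v\<in>E. Ck_on k E S (\<lambda>x. dir_deriv f x v))"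
proof
  assume "Ck_on (Suc k) E S f"
  then obtain f' where f': "\<And>x. x \<in> S \<Longrightarrow> (f has_derivative f' x) (at x within S)"
    "\<And>v. v \<in> E \<Longrightarrow> Ck_on k E S (\<lambda>x. f' x v)" by auto
  have "Ck_on k E S (\<lambda>x. dir_deriv f x v)" if "v \<in> E" for v
    using f'(2)[OF that] Ck_on_cong[of S "\<lambda>x. f' x v" "\<lambda>x. dir_deriv f x v"]
      dir_deriv_eq[OF assms _ that f'(1)] by auto
  then show "(\<forall>x\<in>S. f differentiable (at x within S)) \<and> (\<forall>v\<in>E. Ck_on k E S (\<lambda>x. dir_deriv f x v))"
    using f'(1) by (auto simp: differentiable_def)
next
  assume *: "(\<forall>x\<in>S. f differentiable (at x within S)) \<and> (\<forall>v\<in>E. Ck_on k E S (\<lambda>x. dir_deriv f x v))"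
  then obtain f' where f': "\<And>x. x \<in> S \<Longrightarrow> (f has_derivative f' x) (at x within S)"
    unfolding differentiable_def by metis
  have "Ck_on k E S (\<lambda>x. f' x v)" if "v \<in> E" for v
    using * that Ck_on_cong[of S "\<lambda>x. f' x v" "\<lambda>x. dir_deriv f x v"]
      dir_deriv_eq[OF assms _ that f'] by auto
  then show "Ck_on (Suc k) E S f"
    using f' by auto
qed

lemma Ck_on_SucD: "Ck_on (Suc k) E S f \<Longrightarrow> Ck_on k E S f"
proof (induction k arbitrary: f)
  case 0
  then show ?case
    by (auto simp: continuous_on_eq_continuous_within intro: has_derivative_continuous)
next
  case (Suc k)
  then show ?case by (metis Ck_on.simps(2))
qed

text \<open>Smoothness of \<theta> on a chart of \<open>P\<close> is checked near each point, where
  the base point stays in one chart of \<open>M\<close>. This passes from such neighbourhoods to the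
  whole chart.\<close>

lemma Ck_on_local:
  assumes E: "subspace E" and S: "openin (top_of_set E) S"
    and loc: "\<And>x. x \<in> S \<Longrightarrow> \<exists>U. openin (top_of_set E) U \<and> x \<in> U \<and> U \<subseteq> S \<and> Ck_on k E U f"
  shows "Ck_on k E S f"
  using loc
proof (induction k arbitrary: f)
  case 0
  have "continuous (at x within S) f" if x: "x \<in> S" for x
  proof -
    obtain U where U: "openin (top_of_set E) U" "x \<in> U" "U \<subseteq> S" "continuous_on U f"
      using 0[OF x] unfolding Ck_on.simps by blast
    obtain T where T: "open T" "U = E \<inter> T"
      using U(1) by (auto simp: openin_open)
    have "S \<subseteq> E" using S openin_imp_subset by blast
    have "at x within U = at x within S"
      using T U \<open>S \<subseteq> E\<close> by (intro at_within_nhd[of _ T]) auto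
    moreover have "continuous (at x within U) f"
      using U by (auto simp: continuous_on_eq_continuous_within)
    ultimately show ?thesis
      by (simp add: continuous_within)
  qed
  then show ?case
    by (simp add: continuous_on_eq_continuous_within)
next
  case (Suc k)
  have "S \<subseteq> E" using S openin_imp_subset by blast
  show ?case
    unfolding Ck_on_Suc_iff[OF E S]
  proof (intro conjI ballI)
    fix x assume "x \<in> S"
    then obtain U where U: "openin (top_of_set E) U" "x \<in> U" "U \<subseteq> S" "Ck_on (Suc k) E U f"
      using Suc.prems by blast
    then obtain D where "(f has_derivative D) (at x within U)"
      by (auto simp: Ck_on_Suc_iff[OF E] differentiable_def)
    then show "f differentiable at x within S"
      using has_derivative_within_openin_mono[OF U(1,2) \<open>S \<subseteq> E\<close>] by (auto simp: differentiable_def)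
  next
    fix v assume "v \<in> E"
    show "Ck_on k E S (\<lambda>x. dir_deriv f x v)"
    proof (rule Suc.IH)
      fix x assume "x \<in> S"
      then obtain U where U: "openin (top_of_set E) U" "x \<in> U" "U \<subseteq> S" "Ck_on (Suc k) E U f"
        using Suc.prems by blast
      have "Ck_on k E U (\<lambda>x. dir_deriv f x v)"
        using U(4) \<open>v \<in> E\<close> unfolding Ck_on_Suc_iff[OF E U(1)] by blast
      with U(1-3) show "\<exists>U. openin (top_of_set E) U \<and> x \<in> U \<and> U \<subseteq> S \<and> Ck_on k E U (\<lambda>x. dir_deriv f x v)"
        by blast
    qed
  qed
qed

section \<open>Closure properties of \<open>Ck_on\<close>\<close>

lemma Ck_on_const: "Ck_on k E S (\<lambda>x. c)"
proof (induction k arbitrary: c)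
  case (Suc k)
  have "((\<lambda>x. c) has_derivative (\<lambda>v. 0)) (at x within S)" for x by simp
  then show ?case using Suc by (auto intro!: exI[of _ "\<lambda>x v. 0"])
qed auto

lemma Ck_on_linear:
  assumes h: "bounded_linear h" shows "Ck_on k E S f \<Longrightarrow> Ck_on k E S (\<lambda>x. h (f x))"
proof (induction k arbitrary: f)
  case 0
  then show ?case using h by (auto intro: bounded_linear.continuous_on)
next
  case (Suc k)
  then obtain f' where f': "\<And>x. x \<in> S \<Longrightarrow> (f has_derivative f' x) (at x within S)"
    "\<And>v. v \<in> E \<Longrightarrow> Ck_on k E S (\<lambda>x. f' x v)" by auto
  show ?case
    unfolding Ck_on.simps
    using bounded_linear.has_derivative[OF h f'(1)] Suc.IH[OF f'(2)]
    by (intro exI[of _ "\<lambda>x v. h (f' x v)"]) auto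
qed

lemma Ck_on_add: "Ck_on k E S f \<Longrightarrow> Ck_on k E S g \<Longrightarrow> Ck_on k E S (\<lambda>x. f x + g x)"
proof (induction k arbitrary: f g)
  case 0
  then show ?case by (auto intro: continuous_on_add)
next
  case (Suc k)
  obtain f' where f': "\<And>x. x \<in> S \<Longrightarrow> (f has_derivative f' x) (at x within S)"
    "\<And>v. v \<in> E \<Longrightarrow> Ck_on k E S (\<lambda>x. f' x v)" using Suc.prems by auto
  obtain g' where g': "\<And>x. x \<in> S \<Longrightarrow> (g has_derivative g' x) (at x within S)"
    "\<And>v. v \<in> E \<Longrightarrow> Ck_on k E S (\<lambda>x. g' x v)" using Suc.prems(2) unfolding Ck_on.simps by blast
  show ?case
    unfolding Ck_on.simps
    using has_derivative_add[OF f'(1) g'(1)] Suc.IH[OF f'(2) g'(2)]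
    by (intro exI[of _ "\<lambda>x v. f' x v + g' x v"]) auto
qed

lemma Ck_on_mult:
  fixes f g :: "'a::euclidean_space \<Rightarrow> real"
  shows "Ck_on k E S f \<Longrightarrow> Ck_on k E S g \<Longrightarrow> Ck_on k E S (\<lambda>x. f x * g x)"
proof (induction k arbitrary: f g)
  case 0
  then show ?case by (auto intro: continuous_on_mult)
next
  case (Suc k)
  \<comment> \<open>The product rule contains \<open>f\<close> and \<open>g\<close> themselves, at
    one order less than the premises provide.\<close>
  note low = Ck_on_SucD[OF Suc.prems(1)] Ck_on_SucD[OF Suc.prems(2)]
  obtain f' where f': "\<And>x. x \<in> S \<Longrightarrow> (f has_derivative f' x) (at x within S)"
    "\<And>v. v \<in> E \<Longrightarrow> Ck_on k E S (\<lambda>x. f' x v)" using Suc.prems by auto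
  obtain g' where g': "\<And>x. x \<in> S \<Longrightarrow> (g has_derivative g' x) (at x within S)"
    "\<And>v. v \<in> E \<Longrightarrow> Ck_on k E S (\<lambda>x. g' x v)" using Suc.prems(2) unfolding Ck_on.simps by blast
  show ?case
    unfolding Ck_on.simps
    using has_derivative_mult[OF f'(1) g'(1)] Suc.IH[OF low(1) g'(2)] Suc.IH[OF f'(2) low(2)]
    by (intro exI[of _ "\<lambda>x v. f x * g' x v + f' x v * g x"]) (auto intro: Ck_on_add)
qed

lemma Ck_on_minus: "Ck_on k E S f \<Longrightarrow> Ck_on k E S (\<lambda>x. - f x)"
  by (rule Ck_on_linear[OF bounded_linear_minus[OF bounded_linear_ident]])

text \<open>The derivative of 1/f is a product that contains 1/f again, now one order lower, so the
  induction closes.\<close>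

lemma Ck_on_inverse:
  fixes f :: "'a::euclidean_space \<Rightarrow> real"
  assumes nz: "\<And>x. x \<in> S \<Longrightarrow> f x \<noteq> 0"
  shows "Ck_on k E S f \<Longrightarrow> Ck_on k E S (\<lambda>x. inverse (f x))"
proof (induction k)
  case 0
  then show ?case using nz by (auto intro: continuous_on_inverse)
next
  case (Suc k)
  obtain f' where f': "\<And>x. x \<in> S \<Longrightarrow> (f has_derivative f' x) (at x within S)"
    "\<And>v. v \<in> E \<Longrightarrow> Ck_on k E S (\<lambda>x. f' x v)" using Suc.prems by auto
  show ?case
    unfolding Ck_on.simps
    using Deriv.has_derivative_inverse[OF nz f'(1)] Suc.IH[OF Ck_on_SucD[OF Suc.prems]] f'(2)
    by (intro exI[of _ "\<lambda>x v. - (inverse (f x) * f' x v * inverse (f x))"])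
       (auto intro!: Ck_on_mult Ck_on_minus)
qed

lemma Ck_on_sum: "(\<And>i. i \<in> I \<Longrightarrow> Ck_on k E S (f i)) \<Longrightarrow> Ck_on k E S (\<lambda>x. \<Sum>i\<in>I. f i x)"
  by (induction I rule: infinite_finite_induct) (auto intro: Ck_on_const Ck_on_add)

lemma Ck_on_prod:
  fixes f :: "'i \<Rightarrow> 'a::euclidean_space \<Rightarrow> real"
  shows "(\<And>i. i \<in> I \<Longrightarrow> Ck_on k E S (f i)) \<Longrightarrow> Ck_on k E S (\<lambda>x. \<Prod>i\<in>I. f i x)"
  by (induction I rule: infinite_finite_induct) (auto intro: Ck_on_const Ck_on_mult)

lemma Ck_on_Pair:
  fixes f :: "'a::euclidean_space \<Rightarrow> 'b::real_normed_vector" and g :: "'a \<Rightarrow> 'c::real_normed_vector"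
  assumes "Ck_on k E S f" "Ck_on k E S g"
  shows "Ck_on k E S (\<lambda>x. (f x, g x))"
proof -
  have "bounded_linear (\<lambda>y::'b. (y, 0::'c))" "bounded_linear (\<lambda>z::'c. (0::'b, z))"
    by (auto intro!: bounded_linear_Pair bounded_linear_ident bounded_linear_zero)
  from Ck_on_add[OF Ck_on_linear[OF this(1) assms(1)] Ck_on_linear[OF this(2) assms(2)]]
  show ?thesis by simp
qed

lemma Ck_on_vec_lambda:
  fixes f :: "'i::finite \<Rightarrow> 'a::euclidean_space \<Rightarrow> real"
  assumes "\<And>i. Ck_on k E S (f i)"
  shows "Ck_on k E S (\<lambda>x. \<chi> i. f i x)"
proof -
  have "Ck_on k E S (\<lambda>x. \<Sum>i\<in>UNIV. f i x *\<^sub>R axis i (1::real))"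
    by (intro Ck_on_sum Ck_on_linear[OF bounded_linear_scaleR_left] assms)
  moreover have "(\<Sum>i\<in>UNIV. f i x *\<^sub>R axis i (1::real)) = (\<chi> i. f i x)" for x
    by (simp add: vec_eq_iff axis_def if_distrib sum.delta cong: if_cong)
  ultimately show ?thesis by simp
qed

lemma Ck_on_det:
  fixes A :: "'a::euclidean_space \<Rightarrow> real^'n^'n"
  assumes "\<And>i j. Ck_on k E S (\<lambda>x. A x $ i $ j)"
  shows "Ck_on k E S (\<lambda>x. det (A x))"
  unfolding det_def by (intro Ck_on_sum Ck_on_mult Ck_on_const Ck_on_prod assms)

text \<open>
  By Cramer's rule, no derivative of the matrix inverse is needed.
\<close>

lemma Ck_on_matrix_inv_mult:
  fixes A :: "'a::euclidean_space \<Rightarrow> real^'n^'n" and b :: "'a \<Rightarrow> real^'n"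
  assumes A: "Ck_on k E S A" and b: "Ck_on k E S b"
    and inv: "\<And>x. x \<in> S \<Longrightarrow> invertible (A x)"
    and u: "\<And>x. x \<in> S \<Longrightarrow> A x *v u x = b x"
  shows "Ck_on k E S u"
proof -
  have comp: "Ck_on k E S (\<lambda>x. A x $ i $ j)" for i j
    using Ck_on_linear[OF bounded_linear_compose[OF bounded_linear_vec_nth bounded_linear_vec_nth] A]
    by simp
  have compb: "Ck_on k E S (\<lambda>x. b x $ i)" for i
    by (rule Ck_on_linear[OF bounded_linear_vec_nth b])
  have compc: "Ck_on k E S (\<lambda>x. if j = l then b x $ i else A x $ i $ j)" for i j l
    by (cases "j = l") (auto simp: comp compb)
  have "Ck_on k E S (\<lambda>x. \<chi> l. det (\<chi> i j. if j = l then b x $ i else A x $ i $ j) * inverse (det (A x)))"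
    using inv
    by (intro Ck_on_vec_lambda Ck_on_mult Ck_on_inverse Ck_on_det)
       (auto simp: compc comp invertible_det_nz)
  moreover have "u x = (\<chi> l. det (\<chi> i j. if j = l then b x $ i else A x $ i $ j) * inverse (det (A x)))"
    if "x \<in> S" for x
    using u[OF that] cramer[of "A x" "u x" "b x"] inv[OF that]
    by (simp add: invertible_det_nz divide_inverse)
  ultimately show ?thesis
    by (subst Ck_on_cong[of S u]) auto
qed

text \<open>The mean value theorem along the segment from \<open>b\<close> to \<open>a\<close>
  reduces the claim to a bound for \<open>f' x - f' z\<close> near \<open>z\<close>. Continuity of
  \<open>f'\<close> is known one direction at a time, so the bound is obtained on an orthonormal
  basis of \<open>E\<close> and summed.\<close>

lemma strictly_differentiable:
  fixes f :: "'a::euclidean_space \<Rightarrow> 'b::euclidean_space"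
  assumes E: "subspace E" and S: "openin (top_of_set E) S" and z: "z \<in> S"
    and f: "Ck_on 1 E S f" and \<epsilon>: "\<epsilon> > 0"
  obtains \<delta> where "\<delta> > 0"
    "\<And>a. a \<in> E \<Longrightarrow> dist a z < \<delta> \<Longrightarrow> a \<in> S"
    "\<And>a b. a \<in> E \<Longrightarrow> b \<in> E \<Longrightarrow> dist a z < \<delta> \<Longrightarrow> dist b z < \<delta> \<Longrightarrow>
       norm (f a - f b - dir_deriv f z (a - b)) \<le> \<epsilon> * norm (a - b)"
proof -
  obtain f' where f': "\<And>x. x \<in> S \<Longrightarrow> (f has_derivative f' x) (at x within S)"
    and cont: "\<And>v. v \<in> E \<Longrightarrow> continuous_on S (\<lambda>x. f' x v)"
    using f by auto
  obtain T where T: "open T" "S = E \<inter> T"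
    using S by (auto simp: openin_open)
  obtain B where B: "B \<subseteq> E" "pairwise orthogonal B" "\<And>x. x \<in> B \<Longrightarrow> norm x = 1"
    "independent B" "span B = E"
    using orthonormal_basis_subspace[OF E] by metis
  have finB: "finite B" using B(4) independent_bound by blast
  \<comment> \<open>The summand 1 keeps \<open>N\<close> positive when \<open>E\<close> is the zero
    space and \<open>B\<close> is empty.\<close>
  define N where "N = real (card B) + 1"
  have "N > 0" by (simp add: N_def)
  have "\<forall>\<^sub>F x in at z within S. \<forall>b\<in>B. dist (f' x b) (f' z b) < \<epsilon> / N"
    using finB
  proof (rule eventually_ball_finite, intro ballI)
    fix b assume "b \<in> B"
    then have "((\<lambda>x. f' x b) \<longlongrightarrow> f' z b) (at z within S)"
      using cont[of b] B(1) z by (auto simp: continuous_on_def)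
    then show "\<forall>\<^sub>F x in at z within S. dist (f' x b) (f' z b) < \<epsilon> / N"
      using \<epsilon> \<open>N > 0\<close> by (intro tendstoD) auto
  qed
  then obtain d1 where d1: "d1 > 0" "\<And>x b. x \<in> S \<Longrightarrow> dist x z < d1 \<Longrightarrow> b \<in> B \<Longrightarrow>
      norm (f' x b - f' z b) \<le> \<epsilon> / N"
    unfolding eventually_at by (metis dist_norm less_imp_le dist_self \<epsilon> \<open>N > 0\<close> divide_pos_pos)
  obtain d2 where d2: "d2 > 0" "ball z d2 \<subseteq> T"
    using T z by (meson IntD2 open_contains_ball)
  define d where "d = min d1 d2"
  have bound: "norm (f' x v - f' z v) \<le> \<epsilon> * norm v" if x: "x \<in> S" "dist x z < d" and v: "v \<in> E" for x v
  proof -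
    have lin: "linear (f' x)" "linear (f' z)"
      using f' x z has_derivative_linear by blast+
    have v_eq: "v = (\<Sum>b\<in>B. (v \<bullet> b) *\<^sub>R b)"
    proof -
      \<comment> \<open>The Gram-Schmidt residual is orthogonal to the span of \<open>B\<close>, to
        which it belongs itself; hence it vanishes.\<close>
      define w where "w = v - (\<Sum>b\<in>B. (b \<bullet> v / (b \<bullet> b)) *\<^sub>R b)"
      have "w \<in> E"
        using v B(1) unfolding w_def
        by (intro subspace_diff[OF E] subspace_sum[OF E] subspace_scale[OF E]) auto
      then have "w \<in> span B" using B(5) by simp
      then have "orthogonal w w"
        using Gram_Schmidt_step[OF B(2), of w v] unfolding w_def by blast
      then have "w = 0" by (simp add: orthogonal_self)
      then show ?thesis using B(3) by (simp add: w_def norm_eq_1 inner_commute)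
    qed
    have "f' x v - f' z v = (\<Sum>b\<in>B. (v \<bullet> b) *\<^sub>R (f' x b - f' z b))"
      by (subst (1 2) v_eq) (simp add: linear_sum[OF lin(1)] linear_sum[OF lin(2)]
         linear_scale[OF lin(1)] linear_scale[OF lin(2)] sum_subtractf scaleR_diff_right)
    also have "norm \<dots> \<le> (\<Sum>b\<in>B. norm v * (\<epsilon> / N))"
    proof (rule sum_norm_le)
      fix b assume b: "b \<in> B"
      have "\<bar>v \<bullet> b\<bar> \<le> norm v"
        using Cauchy_Schwarz_ineq2[of v b] B(3)[OF b] by simp
      then show "norm ((v \<bullet> b) *\<^sub>R (f' x b - f' z b)) \<le> norm v * (\<epsilon> / N)"
        using d1(2)[OF x(1) _ b] x(2) unfolding norm_scaleR
        by (intro mult_mono) (auto simp: d_def)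
    qed
    also have "\<dots> = (real (card B) / N) * (\<epsilon> * norm v)" by simp
    also have "\<dots> \<le> 1 * (\<epsilon> * norm v)"
      using \<epsilon> by (intro mult_right_mono) (auto simp: N_def)
    finally show ?thesis by simp
  qed
  have main: "norm (f a - f b - f' z (a - b)) \<le> \<epsilon> * norm (a - b)"
    if ab: "a \<in> E" "b \<in> E" "dist a z < d" "dist b z < d" for a b
  proof -
    define q where "q = (\<lambda>t::real. b + t *\<^sub>R (a - b))"
    have q: "q t \<in> S" "dist (q t) z < d" if "t \<in> {0..1}" for t
    proof -
      have "q t = (1 - t) *\<^sub>R b + t *\<^sub>R a" by (simp add: q_def algebra_simps)
      moreover have "(1 - t) *\<^sub>R b + t *\<^sub>R a \<in> ball z d"
        using ab that by (intro convexD_alt[OF convex_ball]) (auto simp: dist_commute)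
      ultimately show qd: "dist (q t) z < d"
        by (simp add: dist_commute)
      then have "q t \<in> T" using d2 by (auto simp: d_def dist_commute)
      moreover have "q t \<in> E" using ab E unfolding q_def
        by (auto intro: subspace_add subspace_scale subspace_diff)
      ultimately show "q t \<in> S" using T by simp
    qed
    have abE: "a - b \<in> E" using ab E subspace_diff by blast
    have lin: "linear (f' z)" using f' z has_derivative_linear by blast
    \<comment> \<open>Subtracting the linear part leaves a function whose derivative is the small
      difference of \<open>f' (q t)\<close> and \<open>f' z\<close> at \<open>a - b\<close>.\<close>
    define \<phi> where "\<phi> = (\<lambda>t. f (q t) - t *\<^sub>R f' z (a - b))"
    have d\<phi>: "(\<phi> has_vector_derivative f' (q t) (a - b) - f' z (a - b)) (at t)" if "t \<in> {0..1}" for t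
    proof -
      have "\<forall>\<^sub>F s in nhds t. q s \<in> S"
        using ab E abE q[OF that] unfolding q_def
        by (intro eventually_nhds_openin[OF S] always_eventually)
           (auto intro: subspace_add subspace_scale)
      then have "((f \<circ> q) has_vector_derivative f' (q t) (a - b)) (at t)"
        using q[OF that] unfolding q_def
        by (intro has_vector_derivative_chain_eventually[where S = S] f' has_vector_derivative_line)
      then show ?thesis
        unfolding \<phi>_def o_def by (auto intro!: derivative_eq_intros)
    qed
    have "continuous_on {0..1} \<phi>"
      using d\<phi> by (intro continuous_at_imp_continuous_on ballI has_vector_derivative_continuous) auto
    then obtain t where t: "t \<in> {0<..<1}"
      "norm (\<phi> 1 - \<phi> 0) \<le> norm ((\<lambda>s. s *\<^sub>R (f' (q t) (a - b) - f' z (a - b))) (1 - 0))"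
      using mvt_general[of 0 1 \<phi> "\<lambda>t s. s *\<^sub>R (f' (q t) (a - b) - f' z (a - b))"] d\<phi>
      unfolding has_vector_derivative_def by auto
    moreover have "\<phi> 1 - \<phi> 0 = f a - f b - f' z (a - b)"
      by (simp add: \<phi>_def q_def)
    ultimately show ?thesis
      using bound[OF q[of t] abE] by simp
  qed
  show thesis
  proof (rule that[of d])
    show "d > 0" using d1 d2 by (simp add: d_def)
    show "a \<in> S" if "a \<in> E" "dist a z < d" for a
      using that d2 T by (auto simp: d_def dist_commute)
    show "norm (f a - f b - dir_deriv f z (a - b)) \<le> \<epsilon> * norm (a - b)"
      if "a \<in> E" "b \<in> E" "dist a z < d" "dist b z < d" for a b
      using main[OF that] dir_deriv_eq[OF E S z _ f'[OF z]] subspace_diff[OF E that(1,2)] by simp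
  qed
qed

section \<open>The matrix exponential as a limit of powers\<close>

text \<open>
  Multiplication on the type of square matrices is componentwise, so the library exponential of a
  Banach algebra is made available through the algebra of endomorphisms.
\<close>

typedef (overloaded) 'a endo = "UNIV :: ('a::euclidean_space \<Rightarrow>\<^sub>L 'a) set"
  morphisms blinfun_of_endo endo_of_blinfun by simp

setup_lifting type_definition_endo

instantiation endo :: (euclidean_space) real_normed_algebra_1
begin

lift_definition zero_endo :: "'a endo" is 0 .
lift_definition one_endo :: "'a endo" is id_blinfun .
lift_definition plus_endo :: "'a endo \<Rightarrow> 'a endo \<Rightarrow> 'a endo" is "(+)" .
lift_definition minus_endo :: "'a endo \<Rightarrow> 'a endo \<Rightarrow> 'a endo" is "(-)" .
lift_definition uminus_endo :: "'a endo \<Rightarrow> 'a endo" is uminus .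
lift_definition times_endo :: "'a endo \<Rightarrow> 'a endo \<Rightarrow> 'a endo" is "(o\<^sub>L)" .
lift_definition scaleR_endo :: "real \<Rightarrow> 'a endo \<Rightarrow> 'a endo" is scaleR .
lift_definition norm_endo :: "'a endo \<Rightarrow> real" is norm .
definition dist_endo :: "'a endo \<Rightarrow> 'a endo \<Rightarrow> real" where "dist_endo x y = norm (x - y)"
definition sgn_endo :: "'a endo \<Rightarrow> 'a endo" where "sgn_endo x = scaleR (inverse (norm x)) x"
definition uniformity_endo :: "('a endo \<times> 'a endo) filter"
  where "uniformity_endo = (INF e\<in>{0 <..}. principal {(x, y). dist x y < e})"
definition open_endo :: "'a endo set \<Rightarrow> bool"
  where "open_endo U = (\<forall>x\<in>U. \<forall>\<^sub>F (x', y) in uniformity. x' = x \<longrightarrow> y \<in> U)"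

instance
proof
  fix x y z :: "'a endo" and a b :: real
  show "x + y + z = x + (y + z)" by transfer simp
  show "x + y = y + x" by transfer simp
  show "0 + x = x" by transfer simp
  show "- x + x = 0" by transfer simp
  show "x - y = x + - y" by transfer simp
  show "a *\<^sub>R (x + y) = a *\<^sub>R x + a *\<^sub>R y" by transfer (simp add: scaleR_add_right)
  show "(a + b) *\<^sub>R x = a *\<^sub>R x + b *\<^sub>R x" by transfer (simp add: scaleR_add_left)
  show "a *\<^sub>R b *\<^sub>R x = (a * b) *\<^sub>R x" by transfer simp
  show "1 *\<^sub>R x = x" by transfer simp
  show "x * y * z = x * (y * z)" by transfer (simp add: blinfun_eqI)
  show "(x + y) * z = x * z + y * z"
    by transfer (auto intro!: blinfun_eqI simp: blinfun.add_left)
  show "x * (y + z) = x * y + x * z"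
    by transfer (auto intro!: blinfun_eqI simp: blinfun.add_left blinfun.add_right)
  show "a *\<^sub>R x * y = a *\<^sub>R (x * y)"
    by transfer (auto intro!: blinfun_eqI simp: blinfun.scaleR_left)
  show "x * a *\<^sub>R y = a *\<^sub>R (x * y)"
    by transfer (auto intro!: blinfun_eqI simp: blinfun.scaleR_left blinfun.scaleR_right)
  show "1 * x = x" by transfer (auto intro!: blinfun_eqI)
  show "x * 1 = x" by transfer (auto intro!: blinfun_eqI)
  \<comment> \<open>The axiom \<open>0 \<noteq> 1\<close> asks for a nonzero vector, and every basis
    vector is one.\<close>
  obtain b :: 'a where "b \<in> Basis" using nonempty_Basis by blast
  have "(id_blinfun :: 'a \<Rightarrow>\<^sub>L 'a) \<noteq> 0"
  proof
    assume "(id_blinfun :: 'a \<Rightarrow>\<^sub>L 'a) = 0"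
    then have "blinfun_apply id_blinfun b = blinfun_apply 0 b" by simp
    then show False using \<open>b \<in> Basis\<close> by simp
  qed
  then show "(0::'a endo) \<noteq> 1" by transfer simp
  show "dist x y = norm (x - y)" by (simp add: dist_endo_def)
  show "sgn x = scaleR (inverse (norm x)) x" by (simp add: sgn_endo_def)
  show "(uniformity :: ('a endo \<times> 'a endo) filter) = (INF e\<in>{0 <..}. principal {(x, y). dist x y < e})"
    by (simp add: uniformity_endo_def)
  show "open U \<longleftrightarrow> (\<forall>x\<in>U. \<forall>\<^sub>F (x', y) in uniformity. x' = x \<longrightarrow> y \<in> U)" for U :: "'a endo set"
    by (simp add: open_endo_def)
  show "norm x = 0 \<longleftrightarrow> x = 0" by transfer simp
  show "norm (x + y) \<le> norm x + norm y" by transfer (rule norm_triangle_ineq)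
  show "norm (a *\<^sub>R x) = \<bar>a\<bar> * norm x" by transfer simp
  show "norm (x * y) \<le> norm x * norm y" by transfer (rule norm_blinfun_compose)
  show "norm (1::'a endo) = 1" by transfer (rule norm_blinfun_id)
qed

end

text \<open>The representation by bounded operators is isometric, so completeness is inherited from
  them.\<close>

instance endo :: (euclidean_space) banach
proof
  fix X :: "nat \<Rightarrow> 'a endo"
  assume X: "Cauchy X"
  have d: "dist (blinfun_of_endo x) (blinfun_of_endo y) = dist x y" for x y :: "'a endo"
    by (simp add: dist_norm norm_endo.rep_eq minus_endo.rep_eq)
  have "Cauchy (\<lambda>n. blinfun_of_endo (X n))"
    using X by (simp add: Cauchy_def d)
  then obtain L where "(\<lambda>n. blinfun_of_endo (X n)) \<longlonglongrightarrow> L"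
    using convergent_eq_Cauchy by blast
  then have "X \<longlonglongrightarrow> endo_of_blinfun L"
    by (simp add: tendsto_dist_iff[of X] tendsto_dist_iff[of _ L] flip: d)
       (simp add: endo_of_blinfun_inverse)
  then show "convergent X" by (auto simp: convergent_def)
qed

text \<open>Telescoping: replacing one factor \<open>z\<close> by \<open>w\<close> at a time costs
  \<open>norm (z - w)\<close> times the norms of the other factors.\<close>

lemma norm_power_diff_le:
  fixes z w :: "'a::real_normed_algebra_1"
  assumes "norm z \<le> M" "norm w \<le> M" "1 \<le> M"
  shows "norm (z ^ n - w ^ n) \<le> real n * M ^ n * norm (z - w)"
proof (induction n)
  case (Suc n)
  have M0: "0 \<le> M" using assms by simp
  have "z ^ Suc n - w ^ Suc n = z * (z ^ n - w ^ n) + (z - w) * w ^ n"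
    by (simp add: algebra_simps)
  also have "norm \<dots> \<le> norm z * norm (z ^ n - w ^ n) + norm (z - w) * norm (w ^ n)"
    by (intro norm_triangle_le add_mono norm_mult_ineq)
  also have "\<dots> \<le> M * (real n * M ^ n * norm (z - w)) + norm (z - w) * M ^ n"
    using assms Suc M0
    by (intro add_mono mult_mono order_refl order_trans[OF norm_power_ineq] power_mono) auto
  \<comment> \<open>Since \<open>1 \<le> M\<close>, one power of \<open>M\<close> is given away
    here; the bound then has the exponent n instead of n - 1, which would be awkward at 0.\<close>
  also have "\<dots> \<le> M * (real n * M ^ n * norm (z - w)) + norm (z - w) * M ^ Suc n"
    using assms by (intro add_mono mult_left_mono power_increasing) auto
  finally show ?case by (simp add: algebra_simps)
qed simp

lemma exp_power_scaleR:
  fixes x :: "'a::{real_normed_algebra_1, banach}"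
  shows "exp x ^ n = exp (real n *\<^sub>R x)"
proof (induction n)
  case (Suc n)
  have "exp (x + real n *\<^sub>R x) = exp x * exp (real n *\<^sub>R x)"
    by (rule exp_add_commuting) simp
  then show ?case using Suc by (simp add: algebra_simps)
qed simp

text \<open>The base \<open>b n\<close> is compared with \<open>exp (a / n)\<close>, whose n-th
  power is exactly \<open>exp a\<close>. Passing to n-th powers multiplies the difference of the
  bases by at most n times a constant, and n times this difference tends to
  \<open>a - a\<close>.\<close>

lemma power_tendsto_exp:
  fixes b :: "nat \<Rightarrow> 'a::{real_normed_algebra_1, banach}"
  assumes b: "(\<lambda>n. real n *\<^sub>R (b n - 1)) \<longlonglongrightarrow> a"
  shows "(\<lambda>n. b n ^ n) \<longlonglongrightarrow> exp a"
proof -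
  obtain c0 where c0: "\<And>n. norm (real n *\<^sub>R (b n - 1)) \<le> c0"
    using BseqE[OF convergent_imp_Bseq[OF convergentI[OF b]]] by blast
  \<comment> \<open>One constant serves both sequences: \<open>exp (c / n)\<close> bounds both
    bases, and its n-th power is \<open>exp c\<close> for every positive n.\<close>
  define c where "c = max c0 (norm a)"
  have c: "norm (real n *\<^sub>R (b n - 1)) \<le> c" "norm a \<le> c" "0 \<le> c" for n
    using order_trans[OF c0[of n], of c] order_trans[OF norm_ge_zero[of a], of c]
    by (simp_all add: c_def)
  define e where "e = (\<lambda>n. exp (a /\<^sub>R real n))"
  have e: "(\<lambda>n. real n *\<^sub>R (e n - 1)) \<longlonglongrightarrow> a"
  proof -
    have "((\<lambda>t. exp (t *\<^sub>R a)) has_vector_derivative exp (0 *\<^sub>R a) * a) (at 0)"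
      by (rule exp_scaleR_has_vector_derivative_right)
    then have "((\<lambda>h. (exp (h *\<^sub>R a) - 1) /\<^sub>R h) \<longlongrightarrow> a) (at 0)"
      using has_vector_derivative_imp_quotient[of "\<lambda>t. exp (t *\<^sub>R a)" a 0] by simp
    moreover have "filterlim (\<lambda>n. inverse (real n)) (at 0) sequentially"
      by (intro filterlim_atI tendsto_inverse_0_at_top filterlim_real_sequentially)
         (auto intro!: eventually_sequentiallyI[of 1])
    ultimately have "(\<lambda>n. (exp (inverse (real n) *\<^sub>R a) - 1) /\<^sub>R inverse (real n)) \<longlonglongrightarrow> a"
      by (rule filterlim_compose)
    then show ?thesis by (simp add: e_def)
  qed
  have "norm (b n ^ n - exp a) \<le> exp c * norm (real n *\<^sub>R (b n - 1) - real n *\<^sub>R (e n - 1))"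
    if n: "n \<ge> 1" for n
  proof -
    have "norm (b n - 1) \<le> c / real n"
      using c(1)[of n] n unfolding norm_scaleR by (simp add: field_simps)
    then have "norm (b n) \<le> 1 + c / real n"
      using norm_triangle_ineq[of "b n - 1" 1] by simp
    also have "\<dots> \<le> exp (c / real n)" by (rule exp_ge_add_one_self)
    finally have B: "norm (b n) \<le> exp (c / real n)" .
    have "norm (e n) \<le> exp (norm (a /\<^sub>R real n))"
      unfolding e_def by (rule norm_exp)
    also have "\<dots> \<le> exp (c / real n)"
      using c n by (simp add: field_simps)
    finally have C: "norm (e n) \<le> exp (c / real n)" .
    have en: "e n ^ n = exp a"
      using n by (simp add: e_def exp_power_scaleR)
    have "norm (b n ^ n - e n ^ n) \<le> real n * exp (c / real n) ^ n * norm (b n - e n)"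
      using B C c(3) by (intro norm_power_diff_le) auto
    also have "exp (c / real n) ^ n = exp c"
      using n by (simp add: exp_of_nat_mult[symmetric])
    also have "real n * exp c * norm (b n - e n) = exp c * norm (real n *\<^sub>R (b n - e n))"
      by simp
    also have "real n *\<^sub>R (b n - e n) = real n *\<^sub>R (b n - 1) - real n *\<^sub>R (e n - 1)"
      by (simp add: algebra_simps)
    finally show ?thesis by (simp add: en)
  qed
  then have le: "\<forall>\<^sub>F n in sequentially. norm (b n ^ n - exp a)
      \<le> exp c * norm (real n *\<^sub>R (b n - 1) - real n *\<^sub>R (e n - 1))"
    by (rule eventually_sequentiallyI)
  have "(\<lambda>n. exp c * norm (real n *\<^sub>R (b n - 1) - real n *\<^sub>R (e n - 1))) \<longlonglongrightarrow> exp c * norm (a - a)"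
    by (intro tendsto_intros b e)
  then have "(\<lambda>n. exp c * norm (real n *\<^sub>R (b n - 1) - real n *\<^sub>R (e n - 1))) \<longlonglongrightarrow> 0"
    by simp
  with le have "(\<lambda>n. b n ^ n - exp a) \<longlonglongrightarrow> 0"
    by (rule Lim_null_comparison)
  then show ?thesis by (simp add: LIM_zero_iff)
qed

section \<open>Transfer of the exponential from endomorphisms to matrices\<close>

definition endo_of_matrix :: "real^'n^'n \<Rightarrow> (real^'n) endo"
  where "endo_of_matrix A = endo_of_blinfun (Blinfun ((*v) A))"

definition matrix_of_endo :: "(real^'n) endo \<Rightarrow> real^'n^'n"
  where "matrix_of_endo f = matrix (blinfun_apply (blinfun_of_endo f))"

lemma apply_endo_of_matrix: "blinfun_apply (blinfun_of_endo (endo_of_matrix A)) = (*v) A"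
  by (simp add: endo_of_matrix_def endo_of_blinfun_inverse bounded_linear_Blinfun_apply
      matrix_vector_mul_bounded_linear)

lemma matrix_of_endo_of_matrix [simp]: "matrix_of_endo (endo_of_matrix A) = A"
  by (simp add: matrix_of_endo_def apply_endo_of_matrix)

lemma endo_eqI:
  "(\<And>x. blinfun_apply (blinfun_of_endo f) x = blinfun_apply (blinfun_of_endo g) x) \<Longrightarrow> f = g"
  by (metis blinfun_eqI blinfun_of_endo_inverse)

lemma endo_of_matrix_mult: "endo_of_matrix (A ** B) = endo_of_matrix A * endo_of_matrix B"
  by (rule endo_eqI) (simp add: apply_endo_of_matrix times_endo.rep_eq matrix_vector_mul_assoc)

lemma endo_of_matrix_1: "endo_of_matrix (mat 1) = 1"
  by (rule endo_eqI) (simp add: apply_endo_of_matrix one_endo.rep_eq)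

lemma endo_of_matrix_power: "endo_of_matrix (((**) A ^^ k) (mat 1)) = endo_of_matrix A ^ k"
  by (induction k) (simp_all add: endo_of_matrix_1 endo_of_matrix_mult)

lemma linear_endo_of_matrix: "linear endo_of_matrix"
  by (rule linearI; rule endo_eqI)
     (simp_all add: apply_endo_of_matrix plus_endo.rep_eq scaleR_endo.rep_eq blinfun.add_left
       blinfun.scaleR_left matrix_vector_mult_add_rdistrib scaleR_matrix_vector_assoc)

lemma bounded_linear_matrix_of_endo: "bounded_linear (matrix_of_endo :: (real^'n) endo \<Rightarrow> real^'n^'n)"
proof -
  have lin: "linear (matrix_of_endo :: (real^'n) endo \<Rightarrow> _)"
    by (rule linearI)
       (simp_all add: matrix_of_endo_def matrix_def vec_eq_iff plus_endo.rep_eq scaleR_endo.rep_eq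
         blinfun.add_left blinfun.scaleR_left)
  \<comment> \<open>Each entry is bounded by \<open>norm f\<close>; the factor counts the
    entries.\<close>
  have "norm (matrix_of_endo f) \<le> norm f * (real CARD('n) * real CARD('n))" for f :: "(real^'n) endo"
  proof -
    have entry: "\<bar>matrix_of_endo f $ i $ j\<bar> \<le> norm f" for i j
    proof -
      have "\<bar>matrix_of_endo f $ i $ j\<bar> \<le> norm (blinfun_apply (blinfun_of_endo f) (axis j 1))"
        by (simp add: matrix_of_endo_def matrix_def component_le_norm_cart)
      also have "\<dots> \<le> norm f * norm (axis j (1::real))"
        by (simp only: norm_endo.rep_eq norm_blinfun)
      finally show ?thesis by simp
    qed
    have "norm (matrix_of_endo f) \<le> (\<Sum>i\<in>UNIV. norm (matrix_of_endo f $ i))"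
      by (simp add: norm_vec_def L2_set_le_sum)
    also have "\<dots> \<le> (\<Sum>i\<in>(UNIV::'n set). \<Sum>j\<in>(UNIV::'n set). norm f)"
      using entry by (intro sum_mono order_trans[OF norm_le_l1_cart]) auto
    finally show ?thesis by (simp add: mult_ac)
  qed
  with lin show ?thesis
    by (intro bounded_linear_intro) (auto simp: linear_add linear_scale)
qed

text \<open>\<open>matrix_of_endo\<close> is bounded and linear, so it may be applied to the
  exponential series term by term.\<close>

lemma mexp_eq: "mexp A = matrix_of_endo (exp (endo_of_matrix A))"
proof -
  have "(\<lambda>k. endo_of_matrix A ^ k /\<^sub>R fact k) sums exp (endo_of_matrix A)"
    by (rule exp_converges)
  from bounded_linear.sums[OF bounded_linear_matrix_of_endo this]
  have "(\<lambda>k. matrix_of_endo (endo_of_matrix A ^ k /\<^sub>R fact k)) sums matrix_of_endo (exp (endo_of_matrix A))" .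
  moreover have "matrix_of_endo (endo_of_matrix A ^ k /\<^sub>R fact k) = (1 / fact k) *\<^sub>R (((**) A ^^ k) (mat 1))" for k
    by (simp add: linear_scale[OF bounded_linear.linear[OF bounded_linear_matrix_of_endo]]
        flip: endo_of_matrix_power inverse_eq_divide)
  ultimately show ?thesis
    unfolding mexp_def by (simp add: sums_iff)
qed

lemma mexp_0: "mexp 0 = mat 1"
  by (simp add: mexp_eq linear_0[OF linear_endo_of_matrix] flip: endo_of_matrix_1)

lemma matrix_power_tendsto_mexp:
  fixes B :: "nat \<Rightarrow> real^'n^'n"
  assumes "(\<lambda>n. real n *\<^sub>R (B n - mat 1)) \<longlonglongrightarrow> A"
  shows "(\<lambda>n. ((**) (B n) ^^ n) (mat 1)) \<longlonglongrightarrow> mexp A"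
proof -
  have lin: "bounded_linear endo_of_matrix"
    using linear_endo_of_matrix linear_conv_bounded_linear by blast
  have "(\<lambda>n. real n *\<^sub>R (endo_of_matrix (B n) - 1)) \<longlonglongrightarrow> endo_of_matrix A"
    using bounded_linear.tendsto[OF lin assms]
    by (simp add: linear_scale[OF linear_endo_of_matrix] linear_diff[OF linear_endo_of_matrix]
        endo_of_matrix_1)
  from bounded_linear.tendsto[OF bounded_linear_matrix_of_endo power_tendsto_exp[OF this]]
  show ?thesis
    by (simp add: mexp_eq flip: endo_of_matrix_power)
qed

section \<open>Curves and tangent maps in charts\<close>

text \<open>Exactly the facts about the source chart that the chain rule for curves uses. They pass
  to products of charts directly (\<open>prod_chart\<close>), so curves in a product manifold can be
  treated without first establishing \<open>smooth_atlas\<close> for it.\<close>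

definition is_chart :: "('m, 'e::euclidean_space) mfd \<Rightarrow> ('m, 'e) chart \<Rightarrow> bool" where
  "is_chart M c \<longleftrightarrow> c \<in> atlas M \<and> subspace (model M) \<and> inj_on (snd c) (fst c) \<and>
     snd c ` fst c \<subseteq> model M"

lemma is_chart_atlas: "smooth_atlas M \<Longrightarrow> c \<in> atlas M \<Longrightarrow> is_chart M c"
  unfolding is_chart_def smooth_atlas_def using openin_imp_subset by blast

lemma chart_at:
  assumes "smooth_atlas M" "p \<in> pts M"
  shows "chart_at M p \<in> atlas M" "p \<in> fst (chart_at M p)"
proof -
  have "\<exists>c. c \<in> atlas M \<and> p \<in> fst c"
    using assms unfolding smooth_atlas_def by blast
  from someI_ex[OF this] show "chart_at M p \<in> atlas M" "p \<in> fst (chart_at M p)"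
    by (auto simp: chart_at_def)
qed

lemma chart_subset_pts: "smooth_atlas M \<Longrightarrow> c \<in> atlas M \<Longrightarrow> fst c \<subseteq> pts M"
  by (auto simp: smooth_atlas_def)

lemma smooth_on_has_derivative:
  assumes "smooth_on E S f" "x \<in> S"
  obtains f' where "(f has_derivative f') (at x within S)"
proof -
  have "Ck_on (Suc 0) E S f"
    using assms by (simp add: smooth_on_def del: Ck_on.simps)
  then show thesis using that assms(2) by auto
qed

lemma smooth_map_chart:
  assumes "smooth_map M N f" "c \<in> atlas M" "c' \<in> atlas N"
  shows "openin (top_of_set (model M)) (snd c ` (fst c \<inter> f -` fst c'))"
    "smooth_on (model M) (snd c ` (fst c \<inter> f -` fst c')) (snd c' \<circ> f \<circ> cinv c)"
  using assms unfolding smooth_map_def by auto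

lemma smooth_map_pts: "smooth_map M N f \<Longrightarrow> p \<in> pts M \<Longrightarrow> f p \<in> pts N"
  by (auto simp: smooth_map_def)

lemma smooth_map_id: "smooth_atlas M \<Longrightarrow> smooth_map M M (\<lambda>p. p)"
  unfolding smooth_map_def smooth_atlas_def by (simp add: o_def vimage_def Int_def)

text \<open>The first condition refers to the topology of the manifold itself: for an immersed
  subgroup, a curve of matrices may be smooth and yet leave the chart domain at once. It also keeps
  the arbitrary values of the chart outside its domain from mattering.\<close>

definition differentiable_in_chart :: "('m, 'e::euclidean_space) chart \<Rightarrow> (real \<Rightarrow> 'm) \<Rightarrow> bool" where
  "differentiable_in_chart c \<gamma> \<longleftrightarrow>
     (\<forall>\<^sub>F t in nhds 0. \<gamma> t \<in> fst c) \<and> (snd c \<circ> \<gamma>) differentiable (at 0)"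

lemma differentiable_in_chart_start: "differentiable_in_chart c \<gamma> \<Longrightarrow> \<gamma> 0 \<in> fst c"
  unfolding differentiable_in_chart_def using eventually_nhds_x_imp_x by fastforce

lemma chart_velocity_in_model:
  assumes "is_chart M c" "differentiable_in_chart c \<gamma>"
  shows "vector_derivative (snd c \<circ> \<gamma>) (at 0) \<in> model M"
proof (rule has_vector_derivative_in_subspace)
  show "((snd c \<circ> \<gamma>) has_vector_derivative vector_derivative (snd c \<circ> \<gamma>) (at 0)) (at 0)"
    using assms by (simp add: differentiable_in_chart_def vector_derivative_works)
  have "\<forall>\<^sub>F t in nhds 0. \<gamma> t \<in> fst c"
    using assms by (simp add: differentiable_in_chart_def)
  then show "\<forall>\<^sub>F t in nhds 0. (snd c \<circ> \<gamma>) t \<in> model M"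
    by eventually_elim (use assms in \<open>auto simp: is_chart_def\<close>)
qed (use assms in \<open>auto simp: is_chart_def\<close>)

text \<open>The chain rule on which all later work with tangent maps rests. The coordinate curve is
  continuous and lies in the model, so it stays in the relatively open domain of the coordinate
  expression of \<open>f\<close>.\<close>

lemma smooth_map_curve:
  assumes f: "smooth_map M N f" and c: "is_chart M c" and c': "c' \<in> atlas N"
    and \<gamma>: "differentiable_in_chart c \<gamma>" and f0: "f (\<gamma> 0) \<in> fst c'"
  shows "differentiable_in_chart c' (f \<circ> \<gamma>)"
    and "vector_derivative (snd c' \<circ> (f \<circ> \<gamma>)) (at 0) =
      dir_deriv (snd c' \<circ> f \<circ> cinv c) (snd c (\<gamma> 0)) (vector_derivative (snd c \<circ> \<gamma>) (at 0))"
proof -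
  define S where "S = snd c ` (fst c \<inter> f -` fst c')"
  define F where "F = snd c' \<circ> f \<circ> cinv c"
  define q where "q = snd c \<circ> \<gamma>"
  define \<xi> where "\<xi> = vector_derivative q (at 0)"
  have cM: "c \<in> atlas M" "subspace (model M)" "inj_on (snd c) (fst c)" "snd c ` fst c \<subseteq> model M"
    using c by (auto simp: is_chart_def)
  have S: "openin (top_of_set (model M)) S" and F: "smooth_on (model M) S F"
    using smooth_map_chart[OF f cM(1) c'] by (auto simp: S_def F_def)
  have q: "(q has_vector_derivative \<xi>) (at 0)"
    using \<gamma> by (simp add: differentiable_in_chart_def vector_derivative_works q_def \<xi>_def)
  have ev: "\<forall>\<^sub>F t in nhds 0. \<gamma> t \<in> fst c"
    using \<gamma> by (simp add: differentiable_in_chart_def)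
  have q0: "q 0 \<in> S"
    using differentiable_in_chart_start[OF \<gamma>] f0 by (auto simp: q_def S_def)
  have evq: "\<forall>\<^sub>F t in nhds 0. q t \<in> model M"
    using ev by eventually_elim (use cM in \<open>auto simp: q_def\<close>)
  have evS: "\<forall>\<^sub>F t in nhds 0. q t \<in> S"
    using eventually_nhds_openin[OF S has_vector_derivative_continuous[OF q] q0 evq] .
  have ev': "\<forall>\<^sub>F t in nhds 0. (f \<circ> \<gamma>) t \<in> fst c'"
    using ev evS
  proof eventually_elim
    case (elim t)
    then obtain y where "y \<in> fst c" "f y \<in> fst c'" "snd c (\<gamma> t) = snd c y"
      by (auto simp: S_def q_def)
    then show ?case using inj_onD[OF cM(3)] elim by fastforce
  qed
  obtain F' where F': "(F has_derivative F') (at (q 0) within S)"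
    using smooth_on_has_derivative[OF F q0] .
  have "((F \<circ> q) has_vector_derivative F' \<xi>) (at 0)"
    by (rule has_vector_derivative_chain_eventually[OF F' q evS])
  moreover have "\<forall>\<^sub>F t in nhds 0. (F \<circ> q) t = (snd c' \<circ> (f \<circ> \<gamma>)) t"
    using ev by eventually_elim (use cM in \<open>simp add: F_def q_def\<close>)
  ultimately have D: "((snd c' \<circ> (f \<circ> \<gamma>)) has_vector_derivative F' \<xi>) (at 0)"
    by (rule has_vector_derivative_cong_nhds)
  then show "differentiable_in_chart c' (f \<circ> \<gamma>)"
    using ev' by (auto simp: differentiable_in_chart_def intro: differentiableI_vector)
  have "\<xi> \<in> model M"
    using chart_velocity_in_model[OF c \<gamma>] by (simp add: \<xi>_def q_def)
  from dir_deriv_eq[OF cM(2) S q0 this F'] D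
  show "vector_derivative (snd c' \<circ> (f \<circ> \<gamma>)) (at 0) =
      dir_deriv (snd c' \<circ> f \<circ> cinv c) (snd c (\<gamma> 0)) (vector_derivative (snd c \<circ> \<gamma>) (at 0))"
    by (simp add: F_def q_def \<xi>_def vector_derivative_at)
qed

text \<open>A change of charts is the coordinate expression of the identity map.\<close>

lemma differentiable_in_any_chart:
  assumes "smooth_atlas M" "c \<in> atlas M" "c' \<in> atlas M" "differentiable_in_chart c \<gamma>" "\<gamma> 0 \<in> fst c'"
  shows "differentiable_in_chart c' \<gamma>"
    and "vector_derivative (snd c' \<circ> \<gamma>) (at 0) =
      dir_deriv (snd c' \<circ> cinv c) (snd c (\<gamma> 0)) (vector_derivative (snd c \<circ> \<gamma>) (at 0))"
  using smooth_map_curve[OF smooth_map_id[OF assms(1)] is_chart_atlas[OF assms(1,2)] assms(3,4)] assms(5)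
  by (simp_all add: o_def)

text \<open>A representative curve for the tangent vector at \<open>p\<close> with component
  \<open>e\<close> in \<open>c\<close>; through it every tangent vector becomes a velocity.\<close>

definition line_curve :: "('m, 'e::euclidean_space) chart \<Rightarrow> 'm \<Rightarrow> 'e \<Rightarrow> real \<Rightarrow> 'm"
  where "line_curve c p e t = cinv c (snd c p + t *\<^sub>R e)"

lemma line_curve:
  assumes M: "smooth_atlas M" and c: "c \<in> atlas M" and p: "p \<in> fst c" and e: "e \<in> model M"
  shows "line_curve c p e 0 = p"
    and "differentiable_in_chart c (line_curve c p e)"
    and "vector_derivative (snd c \<circ> line_curve c p e) (at 0) = e"
proof -
  have inj: "inj_on (snd c) (fst c)" and op: "openin (top_of_set (model M)) (snd c ` fst c)"
    and sub: "subspace (model M)"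
    using M c by (auto simp: smooth_atlas_def)
  show "line_curve c p e 0 = p"
    using inj p by (simp add: line_curve_def)
  have ev: "\<forall>\<^sub>F t in nhds 0. snd c p + t *\<^sub>R e \<in> snd c ` fst c"
    using p by (intro eventually_line_openin[OF sub op _ e]) auto
  then have ev1: "\<forall>\<^sub>F t in nhds 0. line_curve c p e t \<in> fst c"
    by eventually_elim (metis line_curve_def inv_into_into)
  have ev2: "\<forall>\<^sub>F t in nhds 0. snd c p + t *\<^sub>R e = (snd c \<circ> line_curve c p e) t"
    using ev by eventually_elim (simp add: line_curve_def f_inv_into_f)
  have D: "((snd c \<circ> line_curve c p e) has_vector_derivative e) (at 0)"
    by (rule has_vector_derivative_cong_nhds[OF has_vector_derivative_line ev2])
  then show "differentiable_in_chart c (line_curve c p e)"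
    using ev1 by (auto simp: differentiable_in_chart_def intro: differentiableI_vector)
  show "vector_derivative (snd c \<circ> line_curve c p e) (at 0) = e"
    using D by (rule vector_derivative_at)
qed

lemma velocity_in_tangent_space:
  assumes M: "smooth_atlas M" and c: "c \<in> atlas M" and \<gamma>: "differentiable_in_chart c \<gamma>"
  shows "velocity M \<gamma> 0 \<in> tangent_space M (\<gamma> 0)"
  unfolding tangent_space_def
proof (intro CollectI conjI ballI allI impI)
  fix d assume d: "d \<in> atlas M" "\<gamma> 0 \<in> fst d"
  have \<gamma>d: "differentiable_in_chart d \<gamma>"
    by (rule differentiable_in_any_chart(1)[OF M c d(1) \<gamma> d(2)])
  show "velocity M \<gamma> 0 d \<in> model M"
    using d chart_velocity_in_model[OF is_chart_atlas[OF M d(1)] \<gamma>d] by (simp add: velocity_def)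
  fix d' assume d': "d' \<in> atlas M" "\<gamma> 0 \<in> fst d'"
  show "velocity M \<gamma> 0 d' = dir_deriv (snd d' \<circ> cinv d) (snd d (\<gamma> 0)) (velocity M \<gamma> 0 d)"
    using d d' differentiable_in_any_chart(2)[OF M d(1) d'(1) \<gamma>d d'(2)] by (simp add: velocity_def)
qed (auto simp: velocity_def)

lemma tangent_of_eq_velocity:
  assumes "smooth_atlas M" "c \<in> atlas M" "p \<in> fst c"
  shows "tangent_of M c p e = velocity M (line_curve c p e) 0"
proof -
  have "inj_on (snd c) (fst c)" using assms by (auto simp: smooth_atlas_def)
  then show ?thesis
    using assms by (auto simp: tangent_of_def velocity_def fun_eq_iff line_curve_def dir_deriv_def o_def)
qed

lemma tangent_of_in_tangent_space:
  assumes "smooth_atlas M" "c \<in> atlas M" "p \<in> fst c" "e \<in> model M"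
  shows "tangent_of M c p e \<in> tangent_space M p"
  using velocity_in_tangent_space[OF assms(1,2) line_curve(2)[OF assms]] line_curve(1)[OF assms]
  by (simp add: tangent_of_eq_velocity[OF assms(1-3)])

lemma tangent_of_self:
  assumes "smooth_atlas M" "c \<in> atlas M" "p \<in> fst c" "e \<in> model M"
  shows "tangent_of M c p e c = e"
proof -
  have "tangent_of M c p e c = vector_derivative (snd c \<circ> line_curve c p e) (at 0)"
    using assms(2,3) line_curve(1)[OF assms]
    by (simp add: tangent_of_eq_velocity[OF assms(1-3)] velocity_def)
  then show ?thesis by (simp only: line_curve(3)[OF assms])
qed

lemma tangent_of_tangent:
  assumes "v \<in> tangent_space M p" "c \<in> atlas M" "p \<in> fst c"
  shows "tangent_of M c p (v c) = v"
proof
  fix c' show "tangent_of M c p (v c) c' = v c'"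
  proof (cases "c' \<in> atlas M \<and> p \<in> fst c'")
    case True
    then have "v c' = dir_deriv (snd c' \<circ> cinv c) (snd c p) (v c)"
      using assms unfolding tangent_space_def by blast
    then show ?thesis using True by (simp add: tangent_of_def)
  next
    case False
    then have "v c' = 0"
      using assms unfolding tangent_space_def by blast
    then show ?thesis using False by (auto simp: tangent_of_def)
  qed
qed

lemma tangent_space_eqI:
  assumes "v \<in> tangent_space M p" "w \<in> tangent_space M p" "c \<in> atlas M" "p \<in> fst c" "v c = w c"
  shows "v = w"
  by (rule trans[OF tangent_of_tangent[OF assms(1,3,4), symmetric, unfolded assms(5)]
        tangent_of_tangent[OF assms(2-4)]])

lemma tangent_space_model: "v \<in> tangent_space M p \<Longrightarrow> c \<in> atlas M \<Longrightarrow> p \<in> fst c \<Longrightarrow> v c \<in> model M"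
  unfolding tangent_space_def by blast

lemma zero_in_tangent_space: "smooth_atlas M \<Longrightarrow> (\<lambda>c. 0) \<in> tangent_space M p"
  by (auto simp: tangent_space_def smooth_atlas_def subspace_0)

text \<open>\<open>tangent_map\<close> differentiates along this very line by definition, so the
  identity holds for an arbitrary map \<open>f\<close>. It is applied to right translations, where
  it reduces the tangent map to a curve in \<open>P\<close>.\<close>

lemma tangent_map_eq_velocity:
  assumes M: "smooth_atlas M" and p: "p \<in> pts M"
  shows "tangent_map M N f p v = velocity N (f \<circ> line_curve (chart_at M p) p (v (chart_at M p))) 0"
proof -
  have "inj_on (snd (chart_at M p)) (fst (chart_at M p))"
    using M chart_at[OF M p] by (auto simp: smooth_atlas_def)
  then show ?thesis
    using chart_at[OF M p]
    by (auto simp: tangent_map_def Let_def velocity_def fun_eq_iff line_curve_def dir_deriv_def o_def)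
qed

text \<open>\<open>tangent_map\<close> computes in \<open>chart_at M (\<gamma> 0)\<close>, so the
  differentiability of \<gamma> is first moved from \<open>c\<close> to that chart.\<close>

lemma tangent_map_velocity:
  assumes M: "smooth_atlas M" and f: "smooth_map M N f" and c: "c \<in> atlas M"
    and \<gamma>: "differentiable_in_chart c \<gamma>"
  shows "tangent_map M N f (\<gamma> 0) (velocity M \<gamma> 0) = velocity N (f \<circ> \<gamma>) 0"
proof -
  have "\<gamma> 0 \<in> pts M"
    using differentiable_in_chart_start[OF \<gamma>] chart_subset_pts[OF M c] by auto
  note d = chart_at[OF M this]
  define d where "d = chart_at M (\<gamma> 0)"
  have dM: "d \<in> atlas M" "\<gamma> 0 \<in> fst d" using d by (auto simp: d_def)
  have \<gamma>d: "differentiable_in_chart d \<gamma>"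
    by (rule differentiable_in_any_chart(1)[OF M c dM(1) \<gamma> dM(2)])
  show ?thesis
  proof
    fix c'
    show "tangent_map M N f (\<gamma> 0) (velocity M \<gamma> 0) c' = velocity N (f \<circ> \<gamma>) 0 c'"
      using smooth_map_curve(2)[OF f is_chart_atlas[OF M dM(1)] _ \<gamma>d, of c'] dM
      by (auto simp: tangent_map_def Let_def velocity_def simp flip: d_def)
  qed
qed

lemma tangent_map_in_tangent_space:
  assumes M: "smooth_atlas M" and N: "smooth_atlas N" and f: "smooth_map M N f"
    and p: "p \<in> pts M" and v: "v \<in> tangent_space M p"
  shows "tangent_map M N f p v \<in> tangent_space N (f p)"
proof -
  define c where "c = chart_at M p"
  have c: "c \<in> atlas M" "p \<in> fst c" using chart_at[OF M p] by (auto simp: c_def)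
  define d where "d = chart_at N (f p)"
  have d: "d \<in> atlas N" "f p \<in> fst d"
    using chart_at[OF N smooth_map_pts[OF f p]] by (auto simp: d_def)
  note l = line_curve[OF M c tangent_space_model[OF v c]]
  have "differentiable_in_chart d (f \<circ> line_curve c p (v c))"
    using smooth_map_curve(1)[OF f is_chart_atlas[OF M c(1)] d(1) l(2)] d l(1) by simp
  from velocity_in_tangent_space[OF N d(1) this] show ?thesis
    using l(1) by (simp add: tangent_map_eq_velocity[OF M p] flip: c_def)
qed

text \<open>Frees the tangent map from the chosen chart: \<open>v\<close> is the velocity of a line
  in \<open>c\<close>, and the rule for velocities holds in any chart.\<close>

lemma tangent_map_in_charts:
  assumes M: "smooth_atlas M" and f: "smooth_map M N f" and c: "c \<in> atlas M" "p \<in> fst c"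
    and d: "d \<in> atlas N" "f p \<in> fst d" and v: "v \<in> tangent_space M p"
  shows "tangent_map M N f p v d = dir_deriv (snd d \<circ> f \<circ> cinv c) (snd c p) (v c)"
proof -
  note l = line_curve[OF M c tangent_space_model[OF v c]]
  have "v = velocity M (line_curve c p (v c)) 0"
    using tangent_of_tangent[OF v c] tangent_of_eq_velocity[OF M c] by simp
  then have "tangent_map M N f p v d = velocity N (f \<circ> line_curve c p (v c)) 0 d"
    using tangent_map_velocity[OF M f c(1) l(2)] l(1) by simp
  also have "\<dots> = vector_derivative (snd d \<circ> (f \<circ> line_curve c p (v c))) (at 0)"
    using d l(1) by (simp add: velocity_def)
  also have "\<dots> = dir_deriv (snd d \<circ> f \<circ> cinv c) (snd c p) (v c)"
    using smooth_map_curve(2)[OF f is_chart_atlas[OF M c(1)] d(1) l(2)] d l by simp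
  finally show ?thesis .
qed

lemma tangent_map_linear:
  assumes M: "smooth_atlas M" and N: "smooth_atlas N" and f: "smooth_map M N f" and p: "p \<in> pts M"
    and v: "v \<in> tangent_space M p" and w: "w \<in> tangent_space M p"
  shows "tangent_map M N f p (tangent_add v w) = tangent_add (tangent_map M N f p v) (tangent_map M N f p w)"
    and "tangent_map M N f p (tangent_scale a v) = tangent_scale a (tangent_map M N f p v)"
proof -
  define c where "c = chart_at M p"
  have c: "c \<in> atlas M" "p \<in> fst c" using chart_at[OF M p] by (auto simp: c_def)
  have sub: "subspace (model M)" using M by (simp add: smooth_atlas_def)
  have inj: "inj_on (snd c) (fst c)" using M c by (auto simp: smooth_atlas_def)
  have vw: "v c \<in> model M" "w c \<in> model M"
    using tangent_space_model[OF v c] tangent_space_model[OF w c] by auto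
  have lin: "dir_deriv F (snd c p) (v c + w c) = dir_deriv F (snd c p) (v c) + dir_deriv F (snd c p) (w c)
     \<and> dir_deriv F (snd c p) (a *\<^sub>R v c) = a *\<^sub>R dir_deriv F (snd c p) (v c)"
    if d: "d \<in> atlas N" "f p \<in> fst d" and F: "F = snd d \<circ> f \<circ> cinv c" for d F
  proof -
    define S where "S = snd c ` (fst c \<inter> f -` fst d)"
    have S: "openin (top_of_set (model M)) S" "smooth_on (model M) S F"
      using smooth_map_chart[OF f c(1) d(1)] by (auto simp: S_def F)
    have pS: "snd c p \<in> S" using c d by (auto simp: S_def)
    obtain F' where F': "(F has_derivative F') (at (snd c p) within S)"
      using smooth_on_has_derivative[OF S(2) pS] .
    have lF: "linear F'" using F' has_derivative_linear by blast
    note e = dir_deriv_eq[OF sub S(1) pS _ F']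
    show ?thesis
      using e[OF vw(1)] e[OF vw(2)] e[OF subspace_add[OF sub vw]] e[OF subspace_scale[OF sub vw(1)], of a]
      by (simp add: linear_add[OF lF] linear_scale[OF lF])
  qed
  show "tangent_map M N f p (tangent_add v w) = tangent_add (tangent_map M N f p v) (tangent_map M N f p w)"
    using lin by (auto simp: fun_eq_iff tangent_map_def Let_def tangent_add_def simp flip: c_def)
  show "tangent_map M N f p (tangent_scale a v) = tangent_scale a (tangent_map M N f p v)"
    using lin by (auto simp: fun_eq_iff tangent_map_def Let_def tangent_scale_def simp flip: c_def)
qed

section \<open>Curves in products and constant curves\<close>

lemma prod_chart:
  assumes "is_chart M c" "is_chart N d"
  shows "is_chart (prod_mfd M N) (fst c \<times> fst d, map_prod (snd c) (snd d))"
proof -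
  have "(fst c \<times> fst d, map_prod (snd c) (snd d)) \<in> atlas (prod_mfd M N)"
    using assms unfolding is_chart_def prod_mfd_def mfd.simps by blast
  then show ?thesis
    using assms unfolding is_chart_def by (auto simp: prod_mfd_def subspace_Times map_prod_inj_on)
qed

lemma differentiable_in_prod_chart:
  assumes "differentiable_in_chart c \<gamma>" "differentiable_in_chart d \<delta>"
  shows "differentiable_in_chart (fst c \<times> fst d, map_prod (snd c) (snd d)) (\<lambda>t. (\<gamma> t, \<delta> t))"
proof -
  have "\<forall>\<^sub>F t in nhds 0. \<gamma> t \<in> fst c" "\<forall>\<^sub>F t in nhds 0. \<delta> t \<in> fst d"
    using assms by (auto simp: differentiable_in_chart_def)
  then have "\<forall>\<^sub>F t in nhds 0. (\<gamma> t, \<delta> t) \<in> fst c \<times> fst d"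
    by eventually_elim auto
  moreover have "(\<lambda>t. ((snd c \<circ> \<gamma>) t, (snd d \<circ> \<delta>) t)) differentiable at 0"
    using assms unfolding differentiable_in_chart_def differentiable_def
    by (blast intro: has_derivative_Pair)
  ultimately show ?thesis
    by (simp add: differentiable_in_chart_def o_def)
qed

lemma differentiable_in_chart_const: "p \<in> fst c \<Longrightarrow> differentiable_in_chart c (\<lambda>t. p)"
  by (simp add: differentiable_in_chart_def o_def)

lemma velocity_const: "velocity M (\<lambda>t. p) 0 = (\<lambda>c. 0)"
  by (auto simp: velocity_def o_def)

section \<open>One-parameter subgroups of Lie subgroups\<close>

locale lie_subgroup_chart =
  fixes G :: "(real^'n^'n, 'k::euclidean_space) mfd" and c :: "(real^'n^'n, 'k) chart"
  assumes G: "lie_subgroup_GL G" and c: "c \<in> atlas G" and one_in_c: "mat 1 \<in> fst c"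
begin

abbreviation "E \<equiv> model G"
abbreviation "U \<equiv> snd c ` fst c"
abbreviation "e \<equiv> snd c (mat 1)"

lemma atlas_G: "smooth_atlas G"
  using G by (simp add: lie_subgroup_GL_def smooth_manifold_def)

lemma subspace_E: "subspace E"
  using atlas_G by (simp add: smooth_atlas_def)

lemma inj_c: "inj_on (snd c) (fst c)"
  using atlas_G c by (simp add: smooth_atlas_def)

lemma open_U: "openin (top_of_set E) U"
  using atlas_G c by (simp add: smooth_atlas_def)

lemma U_subset: "U \<subseteq> E"
  using open_U openin_imp_subset by blast

lemma e_in_E: "e \<in> E"
  using U_subset one_in_c by blast

lemma c_cinv: "x \<in> U \<Longrightarrow> snd c (cinv c x) = x" "x \<in> U \<Longrightarrow> cinv c x \<in> fst c"
  by (simp_all add: f_inv_into_f inv_into_into)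

lemma cinv_c: "a \<in> fst c \<Longrightarrow> cinv c (snd c a) = a"
  by (simp add: inj_c)

text \<open>The only chart of \<open>GL_mfd\<close> is the identity on invertible matrices, so the
  inclusion in the coordinates of \<open>c\<close> is \<open>cinv c\<close> itself.\<close>

lemma smooth_inclusion: "smooth_on E U (cinv c)"
proof -
  have "smooth_map G GL_mfd (\<lambda>a. a)"
    using G by (simp add: lie_subgroup_GL_def immersion_def)
  moreover have "(UNIV \<inter> {A. invertible A}, id) \<in> atlas (GL_mfd :: (real^'n^'n, real^'n^'n) mfd)"
    by (simp add: GL_mfd_def open_submfd_def euclidean_mfd_def)
  ultimately have "smooth_on E (snd c ` (fst c \<inter> (\<lambda>a. a) -` {A. invertible A})) (id \<circ> (\<lambda>a. a) \<circ> cinv c)"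
    using smooth_map_chart(2)[OF _ c] by fastforce
  moreover have "fst c \<inter> (\<lambda>a. a) -` {A. invertible A} = fst c"
    using G chart_subset_pts[OF atlas_G c] by (auto simp: lie_subgroup_GL_def)
  ultimately show ?thesis by (simp add: o_def)
qed

text \<open>
  In a chart, left multiplication by a point \<open>y\<close> near the identity \<open>e\<close> is translation by \<open>y - e\<close> up to
  an error that is small relative to \<open>y - e\<close>: this is strict differentiability of the multiplication
  at \<open>(e, e)\<close>, applied to \<open>(y, x)\<close> and \<open>(e, x)\<close>.
\<close>

lemma mult_chart_estimate:
  assumes "\<epsilon> > 0"
  obtains \<delta> where "\<delta> > 0" "\<And>x. x \<in> E \<Longrightarrow> dist x e < \<delta> \<Longrightarrow> x \<in> U"
    "\<And>x y. x \<in> E \<Longrightarrow> y \<in> E \<Longrightarrow> dist x e < \<delta> \<Longrightarrow> dist y e < \<delta> \<Longrightarrow>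
       cinv c y ** cinv c x \<in> fst c \<and>
       norm (snd c (cinv c y ** cinv c x) - x - (y - e)) \<le> \<epsilon> * norm (y - e)"
proof -
  define m where "m = (\<lambda>(a :: real^'n^'n, b :: real^'n^'n). a ** b)"
  define cc where "cc = (fst c \<times> fst c, map_prod (snd c) (snd c))"
  define S where "S = snd cc ` (fst cc \<inter> m -` fst c)"
  define F where "F = snd c \<circ> m \<circ> cinv cc"
  have m: "smooth_map (prod_mfd G G) G m"
    using G by (simp add: lie_subgroup_GL_def m_def)
  have cc: "is_chart (prod_mfd G G) cc"
    unfolding cc_def by (intro prod_chart is_chart_atlas atlas_G c)
  have mod: "model (prod_mfd G G) = E \<times> E"
    by (simp add: prod_mfd_def)
  have S: "openin (top_of_set (E \<times> E)) S" and F: "smooth_on (E \<times> E) S F"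
    using smooth_map_chart[OF m _ c, of cc] cc mod unfolding is_chart_def S_def F_def by auto
  have EE: "subspace (E \<times> E)" by (intro subspace_Times subspace_E)
  have inv_cc: "cinv cc (x, y) = (cinv c x, cinv c y)" if "x \<in> U" "y \<in> U" for x y
  proof (rule inv_into_f_eq)
    show "inj_on (snd cc) (fst cc)" using cc by (simp add: is_chart_def)
  qed (use that c_cinv in \<open>auto simp: cc_def\<close>)
  have F_eq: "F (x, y) = snd c (cinv c x ** cinv c y)" if "x \<in> U" "y \<in> U" for x y
    using inv_cc[OF that] by (simp add: F_def m_def)
  have S_D: "x \<in> U \<and> y \<in> U \<and> cinv c x ** cinv c y \<in> fst c" if "(x, y) \<in> S" for x y
    using that by (auto simp: S_def cc_def m_def cinv_c)
  have eS: "(e, e) \<in> S"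
    unfolding S_def using one_in_c by (intro image_eqI[of _ _ "(mat 1, mat 1)"]) (auto simp: cc_def m_def)
  have eU: "e \<in> U" using one_in_c by simp
  have "Ck_on 1 (E \<times> E) S F" using F by (simp add: smooth_on_def)
  from strictly_differentiable[OF EE S eS this assms] obtain d where d: "d > 0"
    "\<And>a. a \<in> E \<times> E \<Longrightarrow> dist a (e, e) < d \<Longrightarrow> a \<in> S"
    "\<And>a b. a \<in> E \<times> E \<Longrightarrow> b \<in> E \<times> E \<Longrightarrow> dist a (e, e) < d \<Longrightarrow> dist b (e, e) < d \<Longrightarrow>
       norm (F a - F b - dir_deriv F (e, e) (a - b)) \<le> \<epsilon> * norm (a - b)"
    by blast
  \<comment> \<open>The distance of pairs is at most the sum of the distances, whence the radius
    \<open>d / 2\<close>.\<close>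
  have close: "dist (x, y) (e, e) < d" if "dist x e < d / 2" "dist y e < d / 2" for x y
  proof -
    have "dist (x, y) (e, e) \<le> \<bar>dist x e\<bar> + \<bar>dist y e\<bar>"
      unfolding dist_Pair_Pair by (rule sqrt_sum_squares_le_sum_abs)
    then show ?thesis using that by simp
  qed
  \<comment> \<open>Multiplication by the identity on the right changes nothing, so the partial
    derivative in the left factor is the identity.\<close>
  have D: "dir_deriv F (e, e) (h, 0) = h" if h: "h \<in> E" for h
  proof -
    have "\<forall>\<^sub>F t in nhds (0::real). e + t *\<^sub>R h \<in> U"
      by (rule eventually_line_openin[OF subspace_E open_U eU h])
    then have "\<forall>\<^sub>F t in nhds 0. e + t *\<^sub>R h = F ((e, e) + t *\<^sub>R (h, 0))"
      by eventually_elim (use eU one_in_c in \<open>simp add: F_eq cinv_c c_cinv\<close>)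
    from has_vector_derivative_cong_nhds[OF has_vector_derivative_line this]
    show ?thesis unfolding dir_deriv_def by (rule vector_derivative_at)
  qed
  show thesis
  proof (rule that[of "d / 2"])
    show "d / 2 > 0" using d by simp
    show xU: "x \<in> U" if "x \<in> E" "dist x e < d / 2" for x
      using d(2)[of "(x, e)"] close[of x e] that d(1) e_in_E S_D[of x e] by auto
    show "cinv c y ** cinv c x \<in> fst c \<and>
       norm (snd c (cinv c y ** cinv c x) - x - (y - e)) \<le> \<epsilon> * norm (y - e)"
      if xy: "x \<in> E" "y \<in> E" "dist x e < d / 2" "dist y e < d / 2" for x y
    proof
      have "(y, x) \<in> S" using d(2)[of "(y, x)"] close[of y x] xy by auto
      then show "cinv c y ** cinv c x \<in> fst c" using S_D by blast
      have "norm (F (y, x) - F (e, x) - dir_deriv F (e, e) ((y, x) - (e, x))) \<le> \<epsilon> * norm ((y, x) - (e, x))"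
        using xy d(1) e_in_E by (intro d(3) close) auto
      moreover have "F (y, x) = snd c (cinv c y ** cinv c x)" "F (e, x) = x"
        using F_eq xU xy eU one_in_c by (simp_all add: cinv_c c_cinv)
      ultimately show "norm (snd c (cinv c y ** cinv c x) - x - (y - e)) \<le> \<epsilon> * norm (y - e)"
        using D[OF subspace_diff[OF subspace_E xy(2) e_in_E]] by simp
    qed
  qed
qed

text \<open>Each further factor moves the chart point by \<open>y - e\<close> with an error of at
  most \<epsilon> times \<open>norm (y - e)\<close>, and these errors add up. The smallness
  assumption bounds the total path, so that every power before the last multiplication is still in
  the ball where \<open>mult_chart_estimate\<close> applies.\<close>

lemma power_chart_estimate:
  assumes \<epsilon>: "\<epsilon> > 0" and y: "y \<in> E" and small: "real n * norm (y - e) * (1 + \<epsilon>) < \<delta>"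
    and \<delta>: "\<delta> > 0" "\<And>x. x \<in> E \<Longrightarrow> dist x e < \<delta> \<Longrightarrow> x \<in> U"
    "\<And>x y. x \<in> E \<Longrightarrow> y \<in> E \<Longrightarrow> dist x e < \<delta> \<Longrightarrow> dist y e < \<delta> \<Longrightarrow>
       cinv c y ** cinv c x \<in> fst c \<and>
       norm (snd c (cinv c y ** cinv c x) - x - (y - e)) \<le> \<epsilon> * norm (y - e)"
  shows "k \<le> n \<Longrightarrow> ((**) (cinv c y) ^^ k) (mat 1) \<in> fst c \<and>
    norm (snd c (((**) (cinv c y) ^^ k) (mat 1)) - e - real k *\<^sub>R (y - e)) \<le> real k * (\<epsilon> * norm (y - e))"
proof (induction k)
  case 0
  then show ?case using one_in_c by simp
next
  case (Suc k)
  define a where "a = ((**) (cinv c y) ^^ k) (mat 1)"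
  define x where "x = snd c a"
  have a: "a \<in> fst c" and ax: "norm (x - e - real k *\<^sub>R (y - e)) \<le> real k * (\<epsilon> * norm (y - e))"
    using Suc by (auto simp: a_def x_def)
  have "norm (x - e) \<le> norm (x - e - real k *\<^sub>R (y - e)) + norm (real k *\<^sub>R (y - e))"
    by (metis diff_add_cancel norm_triangle_ineq)
  also have "\<dots> \<le> real k * norm (y - e) * (1 + \<epsilon>)"
    using ax unfolding norm_scaleR by (simp add: distrib_left distrib_right mult_ac)
  also have "\<dots> \<le> real n * norm (y - e) * (1 + \<epsilon>)"
    using Suc.prems \<epsilon> by (intro mult_right_mono) auto
  finally have x\<delta>: "dist x e < \<delta>" using small by (simp add: dist_norm)
  have "1 * norm (y - e) * 1 \<le> real n * norm (y - e) * (1 + \<epsilon>)"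
    using Suc.prems \<epsilon> by (intro mult_mono) auto
  then have y\<delta>: "dist y e < \<delta>" using small by (simp add: dist_norm)
  have xE: "x \<in> E" using U_subset a by (auto simp: x_def)
  have cx: "cinv c x = a" using a by (simp add: x_def cinv_c)
  from \<delta>(3)[OF xE y x\<delta> y\<delta>] have *: "cinv c y ** a \<in> fst c"
    "norm (snd c (cinv c y ** a) - x - (y - e)) \<le> \<epsilon> * norm (y - e)"
    by (auto simp: cx)
  have "norm (snd c (cinv c y ** a) - e - real (Suc k) *\<^sub>R (y - e)) =
      norm ((snd c (cinv c y ** a) - x - (y - e)) + (x - e - real k *\<^sub>R (y - e)))"
    by (simp add: algebra_simps)
  also have "\<dots> \<le> \<epsilon> * norm (y - e) + real k * (\<epsilon> * norm (y - e))"
    using *(2) ax by (intro norm_triangle_le add_mono)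
  also have "\<dots> = real (Suc k) * (\<epsilon> * norm (y - e))" by (simp add: algebra_simps)
  finally show ?case using *(1) by (simp add: a_def)
qed

text \<open>
  The powers \<open>(cinv c (e + (t / n) w)) ^ n\<close> stay in a compact part of the chart and converge to
  \<open>mexp (t \<alpha>)\<close> as matrices. A convergent subsequence in the chart therefore shows that \<open>mexp (t \<alpha>)\<close>
  lies in the subgroup, with the same error bound in the chart of the subgroup.
\<close>

lemma mexp_chart_estimate:
  assumes \<epsilon>: "\<epsilon> > 0" and w: "w \<in> E" and small: "\<bar>t\<bar> * norm w * (1 + \<epsilon>) < \<delta>"
    and \<delta>: "\<delta> > 0" "\<And>x. x \<in> E \<Longrightarrow> dist x e < \<delta> \<Longrightarrow> x \<in> U"
    "\<And>x y. x \<in> E \<Longrightarrow> y \<in> E \<Longrightarrow> dist x e < \<delta> \<Longrightarrow> dist y e < \<delta> \<Longrightarrow>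
       cinv c y ** cinv c x \<in> fst c \<and>
       norm (snd c (cinv c y ** cinv c x) - x - (y - e)) \<le> \<epsilon> * norm (y - e)"
  defines "A \<equiv> mexp (t *\<^sub>R dir_deriv (cinv c) e w)"
  shows "A \<in> fst c \<and> norm (snd c A - e - t *\<^sub>R w) \<le> \<epsilon> * (\<bar>t\<bar> * norm w)"
proof -
  \<comment> \<open>Then n steps of size \<open>y n - e\<close> add up to
    \<open>t *\<^sub>R w\<close>. At n = 0 the quotient is 0 and the estimate may fail, which
    explains the shift by \<open>Suc\<close> below.\<close>
  define y where "y = (\<lambda>n. e + (t / real n) *\<^sub>R w)"
  define B where "B = (\<lambda>n. ((**) (cinv c (y n)) ^^ n) (mat 1))"
  have yE: "y n \<in> E" for n
    using w e_in_E subspace_E by (auto simp: y_def intro: subspace_add subspace_scale)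
  have yn: "real n * norm (y n - e) = \<bar>t\<bar> * norm w" if "n > 0" for n
    using that by (simp add: y_def)
  have B: "B n \<in> fst c" "norm (snd c (B n) - e - t *\<^sub>R w) \<le> \<epsilon> * (\<bar>t\<bar> * norm w)" if n: "n > 0" for n
  proof -
    have "real n * norm (y n - e) * (1 + \<epsilon>) < \<delta>"
      using small by (simp only: yn[OF n])
    from power_chart_estimate[OF \<epsilon> yE this \<delta>, of n]
    have "B n \<in> fst c" "norm (snd c (B n) - e - real n *\<^sub>R (y n - e)) \<le> real n * (\<epsilon> * norm (y n - e))"
      by (auto simp: B_def)
    moreover have "real n *\<^sub>R (y n - e) = t *\<^sub>R w" using n by (simp add: y_def)
    moreover have "real n * (\<epsilon> * norm (y n - e)) = \<epsilon> * (\<bar>t\<bar> * norm w)"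
      using yn[OF n] by (simp add: mult.left_commute)
    ultimately show "B n \<in> fst c" "norm (snd c (B n) - e - t *\<^sub>R w) \<le> \<epsilon> * (\<bar>t\<bar> * norm w)"
      by auto
  qed
  \<comment> \<open>Neither centre nor radius depends on n. The intersection with \<open>E\<close>
    keeps limits in the model space.\<close>
  define K where "K = cball (e + t *\<^sub>R w) (\<epsilon> * (\<bar>t\<bar> * norm w)) \<inter> E"
  have "compact K"
    unfolding K_def by (intro compact_Int_closed closed_subspace subspace_E compact_cball)
  moreover have "\<forall>n. snd c (B (Suc n)) \<in> K"
    using B[of "Suc _"] U_subset
    by (auto simp: K_def dist_norm norm_minus_commute[of "e + t *\<^sub>R w"] diff_diff_eq)
  ultimately obtain x r where x: "x \<in> K" and r: "strict_mono (r :: nat \<Rightarrow> nat)"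
    and lim: "((\<lambda>n. snd c (B (Suc n))) \<circ> r) \<longlonglongrightarrow> x"
    unfolding compact_def by metis
  have xE: "x \<in> E" and xt: "norm (x - e - t *\<^sub>R w) \<le> \<epsilon> * (\<bar>t\<bar> * norm w)"
    using x by (auto simp: K_def dist_norm norm_minus_commute[of "e + t *\<^sub>R w"] diff_diff_eq)
  have "norm (x - e) \<le> norm (x - e - t *\<^sub>R w) + norm (t *\<^sub>R w)"
    by (metis diff_add_cancel norm_triangle_ineq)
  also have "\<dots> \<le> \<bar>t\<bar> * norm w * (1 + \<epsilon>)"
    using xt by (simp add: algebra_simps)
  \<comment> \<open>This places the limit inside the image of the chart, where \<open>cinv c\<close>
    is continuous.\<close>
  finally have "dist x e < \<delta>" using small by (simp add: dist_norm)
  then have xU: "x \<in> U" using \<delta>(2) xE by blast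
  obtain \<iota>' where \<iota>': "(cinv c has_derivative \<iota>') (at e within U)"
    using smooth_on_has_derivative[OF smooth_inclusion, of e] one_in_c by auto
  have "continuous_on U (cinv c)"
    using smooth_inclusion unfolding smooth_on_def by (metis Ck_on.simps(1))
  then have "(\<lambda>n. cinv c (((\<lambda>n. snd c (B (Suc n))) \<circ> r) n)) \<longlonglongrightarrow> cinv c x"
    using continuous_on_tendsto_compose[OF _ lim xU] B(1)[of "Suc _"] by auto
  then have lim1: "(\<lambda>n. B (Suc (r n))) \<longlonglongrightarrow> cinv c x"
    using B(1)[of "Suc _"] by (simp add: cinv_c)
  define \<alpha> where "\<alpha> = dir_deriv (cinv c) e w"
  have \<alpha>: "\<alpha> = \<iota>' w"
    unfolding \<alpha>_def using one_in_c by (intro dir_deriv_eq[OF subspace_E open_U _ w \<iota>']) auto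
  \<comment> \<open>At h = 1/n this curve passes through \<open>cinv c (y n)\<close>; its difference
    quotients there are the sequence required by \<open>matrix_power_tendsto_mexp\<close>.\<close>
  have "((\<lambda>h. cinv c (e + h *\<^sub>R t *\<^sub>R w)) has_vector_derivative \<iota>' (t *\<^sub>R w)) (at 0)"
    using one_in_c subspace_scale[OF subspace_E w]
    by (intro has_vector_derivative_dir_deriv[OF subspace_E open_U _ _ \<iota>']) auto
  moreover have "\<iota>' (t *\<^sub>R w) = t *\<^sub>R \<alpha>"
    using has_derivative_linear[OF \<iota>'] by (simp add: \<alpha> linear_scale)
  ultimately have q: "((\<lambda>h. (cinv c (e + h *\<^sub>R t *\<^sub>R w) - mat 1) /\<^sub>R h) \<longlongrightarrow> t *\<^sub>R \<alpha>) (at 0)"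
    using has_vector_derivative_imp_quotient[of "\<lambda>h. cinv c (e + h *\<^sub>R t *\<^sub>R w)" _ 0]
    by (simp add: cinv_c[OF one_in_c])
  have "filterlim (\<lambda>n. inverse (real n)) (at 0) sequentially"
    by (intro filterlim_atI tendsto_inverse_0_at_top filterlim_real_sequentially)
       (auto intro!: eventually_sequentiallyI[of 1])
  from filterlim_compose[OF q this]
  have "(\<lambda>n. real n *\<^sub>R (cinv c (y n) - mat 1)) \<longlonglongrightarrow> t *\<^sub>R \<alpha>"
    by (simp add: y_def divide_inverse mult.commute)
  then have "B \<longlonglongrightarrow> A"
    unfolding B_def A_def \<alpha>_def[symmetric] by (rule matrix_power_tendsto_mexp)
  then have "(B \<circ> (Suc \<circ> r)) \<longlonglongrightarrow> A"
    using r by (intro LIMSEQ_subseq_LIMSEQ) (auto simp: strict_mono_def)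
  then have "A = cinv c x"
    using lim1 LIMSEQ_unique by (auto simp: o_def)
  then show ?thesis
    using xU xt by (simp add: c_cinv)
qed

text \<open>The estimate of \<open>mexp_chart_estimate\<close> is available for every \<epsilon>, on
  an interval that depends on \<epsilon>. This is differentiability at 0 with derivative
  \<open>w\<close>.\<close>

lemma mexp_differentiable_in_chart:
  assumes w: "w \<in> E"
  shows "differentiable_in_chart c (\<lambda>t. mexp (t *\<^sub>R dir_deriv (cinv c) e w))"
proof -
  define \<gamma> where "\<gamma> = (\<lambda>t. mexp (t *\<^sub>R dir_deriv (cinv c) e w))"
  have est: "\<exists>d>0. \<forall>t. \<bar>t\<bar> < d \<longrightarrow> \<gamma> t \<in> fst c \<and> norm (snd c (\<gamma> t) - e - t *\<^sub>R w) \<le> \<epsilon> * \<bar>t\<bar>"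
    if \<epsilon>: "\<epsilon> > 0" for \<epsilon>
  proof -
    \<comment> \<open>Running the estimate with \<epsilon> divided by \<open>N\<close> absorbs the
      factor \<open>norm w\<close>; the summand 1 covers \<open>w = 0\<close>.\<close>
    define N where "N = norm w + 1"
    have N: "N > 0" "norm w \<le> N" using norm_ge_zero[of w] by (simp_all add: N_def add_nonneg_pos)
    have \<epsilon>N: "\<epsilon> / N > 0" using \<epsilon> N by simp
    obtain \<delta> where \<delta>: "\<delta> > 0" "\<And>x. x \<in> E \<Longrightarrow> dist x e < \<delta> \<Longrightarrow> x \<in> U"
      "\<And>x y. x \<in> E \<Longrightarrow> y \<in> E \<Longrightarrow> dist x e < \<delta> \<Longrightarrow> dist y e < \<delta> \<Longrightarrow>
         cinv c y ** cinv c x \<in> fst c \<and>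
         norm (snd c (cinv c y ** cinv c x) - x - (y - e)) \<le> \<epsilon> / N * norm (y - e)"
      using mult_chart_estimate[OF \<epsilon>N] by blast
    \<comment> \<open>Chosen so that \<open>\<bar>t\<bar> < d\<close> gives the smallness condition
      of \<open>mexp_chart_estimate\<close>, with \<open>norm w\<close> enlarged to
      \<open>N\<close>.\<close>
    define d where "d = \<delta> / (N * (1 + \<epsilon> / N))"
    have pos: "N * (1 + \<epsilon> / N) > 0" using N \<epsilon>N by (intro mult_pos_pos) auto
    show ?thesis
    proof (intro exI[of _ d] conjI allI impI)
      show "d > 0" using \<delta>(1) pos by (simp add: d_def)
      fix t assume t: "\<bar>t\<bar> < d"
      have "\<bar>t\<bar> * norm w * (1 + \<epsilon> / N) \<le> \<bar>t\<bar> * N * (1 + \<epsilon> / N)"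
        using N \<epsilon>N by (intro mult_right_mono mult_left_mono) auto
      also have "\<dots> < \<delta>"
        using t pos by (simp add: d_def pos_less_divide_eq mult.assoc)
      finally have *: "\<gamma> t \<in> fst c \<and> norm (snd c (\<gamma> t) - e - t *\<^sub>R w) \<le> \<epsilon> / N * (\<bar>t\<bar> * norm w)"
        unfolding \<gamma>_def by (intro mexp_chart_estimate[OF \<epsilon>N w _ \<delta>])
      moreover have "\<epsilon> / N * (\<bar>t\<bar> * norm w) \<le> \<epsilon> / N * (\<bar>t\<bar> * N)"
        using N \<epsilon>N by (intro mult_left_mono) auto
      ultimately show "norm (snd c (\<gamma> t) - e - t *\<^sub>R w) \<le> \<epsilon> * \<bar>t\<bar>"
        using N by simp
      show "\<gamma> t \<in> fst c" using * by simp
    qed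
  qed
  obtain d where "d > 0" "\<And>t. \<bar>t\<bar> < d \<Longrightarrow> \<gamma> t \<in> fst c"
    using est[of 1] by auto
  then have ev: "\<forall>\<^sub>F t in nhds 0. \<gamma> t \<in> fst c"
    unfolding eventually_nhds_metric by (intro exI[of _ d]) auto
  have "((snd c \<circ> \<gamma>) has_derivative (\<lambda>t. t *\<^sub>R w)) (at 0)"
    unfolding has_derivative_at_alt
  proof (intro conjI allI impI)
    show "bounded_linear (\<lambda>t. t *\<^sub>R w)" by (rule bounded_linear_scaleR_left)
    fix \<epsilon> :: real assume "\<epsilon> > 0"
    with est[of \<epsilon>] show "\<exists>d>0. \<forall>t. norm (t - 0) < d \<longrightarrow>
        norm ((snd c \<circ> \<gamma>) t - (snd c \<circ> \<gamma>) 0 - (t - 0) *\<^sub>R w) \<le> \<epsilon> * norm (t - 0)"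
      by (auto simp: \<gamma>_def mexp_0)
  qed
  then show ?thesis
    using ev unfolding \<gamma>_def[symmetric] differentiable_in_chart_def differentiable_def by blast
qed

lemma lie_algebraE:
  assumes "\<alpha> \<in> lie_algebra G"
  obtains w where "w \<in> E" "\<alpha> = dir_deriv (cinv c) e w"
proof -
  have incl: "smooth_map G GL_mfd (\<lambda>a. a)"
    using G by (simp add: lie_subgroup_GL_def immersion_def)
  have GL: "({A. invertible A}, id) \<in> atlas (GL_mfd :: (real^'n^'n, real^'n^'n) mfd)"
    by (simp add: GL_mfd_def open_submfd_def euclidean_mfd_def)
  have inv1: "invertible (mat 1 :: real^'n^'n)"
    by (simp add: invertible_def exI[of _ "mat 1"])
  obtain v where v: "v \<in> tangent_space G (mat 1)"
    and \<alpha>: "\<alpha> = tangent_map G GL_mfd (\<lambda>a. a) (mat 1) v ({A. invertible A}, id)"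
    using assms by (auto simp: lie_algebra_def)
  have "\<alpha> = dir_deriv (cinv c) e (v c)"
    using tangent_map_in_charts[OF atlas_G incl c one_in_c GL _ v] inv1
    by (simp add: \<alpha> o_def)
  with tangent_space_model[OF v c one_in_c] show thesis by (rule that)
qed

lemma exp_curve:
  assumes "\<alpha> \<in> lie_algebra G" shows "differentiable_in_chart c (\<lambda>t. mexp (t *\<^sub>R \<alpha>))"
  using lie_algebraE[OF assms] mexp_differentiable_in_chart by blast

end

section \<open>The tautological form and flat connections\<close>

lemma Forms1_linear_image:
  assumes h: "bounded_linear h" and \<omega>: "\<omega> \<in> Forms1 M W" and W: "h ` W \<subseteq> W'"
  shows "(\<lambda>p v. h (\<omega> p v)) \<in> Forms1 M W'"
proof -
  have "smooth_on (model M) (snd c ` fst c) (\<lambda>x. form1_in_chart M c (\<lambda>p v. h (\<omega> p v)) x e)"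
    if "c \<in> atlas M" "e \<in> model M" for c e
    unfolding smooth_on_def form1_in_chart_def
  proof (rule allI, rule Ck_on_linear[OF h])
    show "Ck_on k (model M) (snd c ` fst c) (\<lambda>x. \<omega> (cinv c x) (tangent_of M c (cinv c x) e))" for k
      using \<omega> that by (simp add: Forms1_def form1_in_chart_def smooth_on_def)
  qed
  moreover have "linear h" using h bounded_linear.linear by blast
  ultimately show ?thesis
    using \<omega> W unfolding Forms1_def by (auto simp: linear_add linear_scale)
qed

text \<open>Applied to \<open>fst\<close> and \<open>snd\<close>, this splits the flatness equation
  into the two structure equations. Agreement of the forms is asked only on tangent vectors, because
  that is all a lift provides for \<theta>; the coordinate expressions evaluate the forms only
  there.\<close>

lemma ext_deriv_linear_image:
  assumes M: "smooth_atlas M" and h: "bounded_linear h" and \<omega>: "\<omega> \<in> Forms1 M W"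
    and eq: "\<And>q u. q \<in> pts M \<Longrightarrow> u \<in> tangent_space M q \<Longrightarrow> \<omega>' q u = h (\<omega> q u)"
    and p: "p \<in> pts M" and v: "v \<in> tangent_space M p" and w: "w \<in> tangent_space M p"
  shows "ext_deriv M \<omega>' p v w = h (ext_deriv M \<omega> p v w)"
proof -
  define c where "c = chart_at M p"
  have c: "c \<in> atlas M" "p \<in> fst c" using chart_at[OF M p] by (auto simp: c_def)
  have sub: "subspace (model M)" and op: "openin (top_of_set (model M)) (snd c ` fst c)"
    using M c by (auto simp: smooth_atlas_def)
  have pS: "snd c p \<in> snd c ` fst c" using c by simp
  have *: "dir_deriv (\<lambda>x. form1_in_chart M c \<omega>' x e) (snd c p) u =
      h (dir_deriv (\<lambda>x. form1_in_chart M c \<omega> x e) (snd c p) u)"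
    if e: "e \<in> model M" and u: "u \<in> model M" for e u
  proof -
    have "smooth_on (model M) (snd c ` fst c) (\<lambda>x. form1_in_chart M c \<omega> x e)"
      using \<omega> c e by (simp add: Forms1_def)
    from smooth_on_has_derivative[OF this pS] obtain D
      where D: "((\<lambda>x. form1_in_chart M c \<omega> x e) has_derivative D) (at (snd c p) within snd c ` fst c)" .
    have "form1_in_chart M c \<omega>' x e = h (form1_in_chart M c \<omega> x e)" if "x \<in> snd c ` fst c" for x
    proof -
      have q: "cinv c x \<in> fst c" using that by (simp add: inv_into_into)
      show ?thesis
        unfolding form1_in_chart_def
        using q chart_subset_pts[OF M c(1)] tangent_of_in_tangent_space[OF M c(1) q e]
        by (intro eq) auto
    qed
    then have "dir_deriv (\<lambda>x. form1_in_chart M c \<omega>' x e) (snd c p) u =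
        dir_deriv (\<lambda>x. h (form1_in_chart M c \<omega> x e)) (snd c p) u"
      by (rule dir_deriv_cong[OF sub op pS u])
    also have "\<dots> = h (D u)"
      by (rule dir_deriv_eq[OF sub op pS u bounded_linear.has_derivative[OF h D]])
    also have "D u = dir_deriv (\<lambda>x. form1_in_chart M c \<omega> x e) (snd c p) u"
      by (rule dir_deriv_eq[OF sub op pS u D, symmetric])
    finally show ?thesis .
  qed
  show ?thesis
    using *[OF tangent_space_model[OF w c] tangent_space_model[OF v c]]
      *[OF tangent_space_model[OF v c] tangent_space_model[OF w c]]
    by (simp add: ext_deriv_def Let_def linear_diff[OF bounded_linear.linear[OF h]] flip: c_def)
qed

lemma matrix_inv_right: "invertible A \<Longrightarrow> A ** matrix_inv A = mat 1"
  unfolding invertible_def matrix_inv_def by (rule someI2_ex) auto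

text \<open>The zero function can serve as a curvature function only if its value lies in the Lie
  algebra.\<close>

lemma zero_in_lie_algebra:
  assumes "lie_subgroup_GL G" shows "0 \<in> lie_algebra G"
proof -
  have "(\<lambda>c. 0) \<in> tangent_space G (mat 1)"
    using assms by (intro zero_in_tangent_space) (simp add: lie_subgroup_GL_def smooth_manifold_def)
  moreover have "0 = tangent_map G GL_mfd (\<lambda>a. a) (mat 1) (\<lambda>c. 0) ({A. invertible A}, id)"
    by (simp add: tangent_map_def Let_def)
  ultimately show ?thesis unfolding lie_algebra_def by blast
qed

locale G_struct =
  fixes G :: "(real^'n^'n, 'k::euclidean_space) mfd"
    and M :: "('m, real^'n) mfd"
    and P :: "(('m, 'n) frame, 'e::euclidean_space) mfd"
  assumes G: "lie_subgroup_GL G" and M: "smooth_manifold M" and P: "G_structure G M P"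
begin

abbreviation theta (\<open>\<theta>\<close>) where "\<theta> \<equiv> tautological_form M P"

lemma principal_bundle_P: "principal_bundle G P M fst frame_act"
  using P by (simp add: G_structure_def)

lemma atlas_G: "smooth_atlas G"
  using G by (simp add: lie_subgroup_GL_def smooth_manifold_def)

lemma atlas_M: "smooth_atlas M"
  using M by (simp add: smooth_manifold_def)

lemma atlas_P: "smooth_atlas P"
  using principal_bundle_P by (simp add: principal_bundle_def smooth_manifold_def)

lemma smooth_proj: "smooth_map P M fst"
  using principal_bundle_P by (simp add: principal_bundle_def)

lemma smooth_act: "smooth_map (prod_mfd P G) P (\<lambda>(p, g). frame_act p g)"
  using principal_bundle_P by (simp add: principal_bundle_def)

lemma act_in_P: "p \<in> pts P \<Longrightarrow> g \<in> pts G \<Longrightarrow> frame_act p g \<in> pts P"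
  using smooth_map_pts[OF smooth_act, of "(p, g)"] by (simp add: prod_mfd_def)

lemma act_one: "p \<in> pts P \<Longrightarrow> frame_act p (mat 1) = p"
  using principal_bundle_P by (simp add: principal_bundle_def)

section \<open>Pointwise properties of the tautological form\<close>

lemma frame:
  assumes "p \<in> pts P"
  shows "snd p (v + w) = tangent_add (snd p v) (snd p w)"
    "snd p (a *\<^sub>R v) = tangent_scale a (snd p v)"
    "bij_betw (snd p) UNIV (tangent_space M (fst p))"
proof -
  have "p \<in> frames M"
    using assms P by (auto simp: G_structure_def)
  then show "snd p (v + w) = tangent_add (snd p v) (snd p w)"
    "snd p (a *\<^sub>R v) = tangent_scale a (snd p v)"
    "bij_betw (snd p) UNIV (tangent_space M (fst p))"
    by (auto simp: frames_def split_beta)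
qed

lemma frame_tautological_form:
  assumes "p \<in> pts P" "v \<in> tangent_space P p"
  shows "snd p (\<theta> p v) = tangent_map P M fst p v"
  unfolding tautological_form_def
  using frame(3)[OF assms(1)] tangent_map_in_tangent_space[OF atlas_P atlas_M smooth_proj assms]
  by (intro f_inv_into_f) (simp add: bij_betw_def)

lemma tautological_form_eqI:
  assumes "p \<in> pts P" "snd p a = tangent_map P M fst p v"
  shows "\<theta> p v = a"
  unfolding tautological_form_def assms(2)[symmetric]
  using frame(3)[OF assms(1)] by (simp add: bij_betw_def)

lemma tautological_form_linear:
  assumes p: "p \<in> pts P" and v: "v \<in> tangent_space P p" and w: "w \<in> tangent_space P p"
  shows "\<theta> p (tangent_add v w) = \<theta> p v + \<theta> p w"
    and "\<theta> p (tangent_scale a v) = a *\<^sub>R \<theta> p v"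
  by (rule tautological_form_eqI[OF p], simp add: frame[OF p] frame_tautological_form[OF p] v w
      tangent_map_linear[OF atlas_P atlas_M smooth_proj p v w])+

text \<open>With \<delta> constant this handles right translations, with \<gamma> constant the
  orbits of one-parameter subgroups.\<close>

lemma act_curve:
  assumes c: "c \<in> atlas P" and \<gamma>: "differentiable_in_chart c \<gamma>"
    and d: "d \<in> atlas G" and \<delta>: "differentiable_in_chart d \<delta>"
  obtains c' where "c' \<in> atlas P" "differentiable_in_chart c' (\<lambda>t. frame_act (\<gamma> t) (\<delta> t))"
proof -
  define a where "a = (\<lambda>(p, g). frame_act p g :: ('m, 'n) frame)"
  have "\<gamma> 0 \<in> pts P" "\<delta> 0 \<in> pts G"
    using differentiable_in_chart_start \<gamma> \<delta> chart_subset_pts atlas_P atlas_G c d by blast+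
  then have "a (\<gamma> 0, \<delta> 0) \<in> pts P" by (simp add: a_def act_in_P)
  note c' = chart_at[OF atlas_P this]
  have "differentiable_in_chart (chart_at P (a (\<gamma> 0, \<delta> 0))) (a \<circ> (\<lambda>t. (\<gamma> t, \<delta> t)))"
    using c' smooth_act
    by (intro smooth_map_curve(1)[OF _ prod_chart[OF is_chart_atlas[OF atlas_P c] is_chart_atlas[OF atlas_G d]]
          _ differentiable_in_prod_chart[OF \<gamma> \<delta>]]) (auto simp: a_def)
  with c'(1) show thesis by (intro that) (auto simp: a_def o_def)
qed

text \<open>Right translation covers the identity of \<open>M\<close>, so \<open>v\<close> and its
  translate have the same projection. The frame \<open>frame_act p g\<close> takes this vector's
  components from the frame \<open>p\<close> multiplied by the inverse of \<open>g\<close>.\<close>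

lemma tautological_form_equivariant: "equivariant_form G P (\<lambda>g v. g *v v) \<theta>"
  unfolding equivariant_form_def
proof (intro ballI)
  fix g p v assume g: "g \<in> pts G" and p: "p \<in> pts P" and v: "v \<in> tangent_space P p"
  define c where "c = chart_at P p"
  have c: "c \<in> atlas P" "p \<in> fst c" using chart_at[OF atlas_P p] by (auto simp: c_def)
  define l where "l = line_curve c p (v c)"
  have l: "l 0 = p" "differentiable_in_chart c l"
    using line_curve[OF atlas_P c tangent_space_model[OF v c]] by (auto simp: l_def)
  obtain c' where c': "c' \<in> atlas P" "differentiable_in_chart c' (\<lambda>t. frame_act (l t) g)"
    using act_curve[OF c(1) l(2) chart_at(1)[OF atlas_G g]
        differentiable_in_chart_const[OF chart_at(2)[OF atlas_G g]]] .
  have "tangent_map P P (\<lambda>q. frame_act q g) p v = velocity P (\<lambda>t. frame_act (l t) g) 0"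
    using tangent_map_eq_velocity[OF atlas_P p, of P "\<lambda>q. frame_act q g" v]
    by (simp add: l_def c_def o_def)
  then have "tangent_map P M fst (frame_act p g) (tangent_map P P (\<lambda>q. frame_act q g) p v) =
      velocity M (fst \<circ> (\<lambda>t. frame_act (l t) g)) 0"
    using tangent_map_velocity[OF atlas_P smooth_proj c'] l(1) by simp
  also have "fst \<circ> (\<lambda>t. frame_act (l t) g) = fst \<circ> l"
    by (auto simp: frame_act_def)
  also have "velocity M (fst \<circ> l) 0 = tangent_map P M fst p v"
    using tangent_map_eq_velocity[OF atlas_P p, of M fst v] by (simp add: l_def c_def)
  finally have push: "tangent_map P M fst (frame_act p g) (tangent_map P P (\<lambda>q. frame_act q g) p v) =
      tangent_map P M fst p v" .
  have "invertible g" using G g by (simp add: lie_subgroup_GL_def)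
  then have "g *v (matrix_inv g *v \<theta> p v) = \<theta> p v"
    by (simp add: matrix_vector_mul_assoc matrix_inv_right)
  then show "\<theta> (frame_act p g) (tangent_map P P (\<lambda>q. frame_act q g) p v) = matrix_inv g *v \<theta> p v"
    using push frame_tautological_form[OF p v]
    by (intro tautological_form_eqI act_in_P p g) (simp add: frame_act_def)
qed

text \<open>The orbit stays in one fibre, so its projection is constant. The chain rule may be used
  only because the orbit is differentiable in \<open>P\<close>; otherwise its
  \<open>velocity\<close> would be an unspecified value.\<close>

lemma tautological_form_fundamental_vector:
  assumes \<alpha>: "\<alpha> \<in> lie_algebra G" and p: "p \<in> pts P"
  shows "\<theta> p (fundamental_vector P \<alpha> p) = 0"
proof (rule tautological_form_eqI[OF p])
  have one: "mat 1 \<in> pts G" using G by (simp add: lie_subgroup_GL_def)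
  interpret lie_subgroup_chart G "chart_at G (mat 1)"
    by unfold_locales (use G chart_at[OF atlas_G one] in auto)
  define \<gamma> where "\<gamma> = (\<lambda>t. frame_act p (mexp (t *\<^sub>R \<alpha>)))"
  obtain c where c: "c \<in> atlas P" "differentiable_in_chart c \<gamma>"
    using act_curve[OF chart_at(1)[OF atlas_P p] differentiable_in_chart_const[OF chart_at(2)[OF atlas_P p]]
        c exp_curve[OF \<alpha>]] unfolding \<gamma>_def .
  have "\<gamma> 0 = p" by (simp add: \<gamma>_def mexp_0 act_one[OF p])
  then have "tangent_map P M fst p (fundamental_vector P \<alpha> p) = velocity M (fst \<circ> \<gamma>) 0"
    using tangent_map_velocity[OF atlas_P smooth_proj c] by (simp add: fundamental_vector_def \<gamma>_def)
  also have "fst \<circ> \<gamma> = (\<lambda>t. fst p)"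
    by (auto simp: \<gamma>_def frame_act_def)
  also have "velocity M \<dots> 0 = (\<lambda>c. 0)" by (rule velocity_const)
  finally show "snd p 0 = tangent_map P M fst p (fundamental_vector P \<alpha> p)"
    using frame(2)[OF p, of 0 0] by (simp add: tangent_scale_def)
qed

text \<open>Near a point, the inclusion into the frame bundle has the smooth coordinates
  \<open>(y x, A x)\<close>: base point and frame matrix. Since \<theta> lists the components of the
  projected vector in the frame, it solves a linear system with matrix \<open>A x\<close> and
  right-hand side the derivative of \<open>y\<close>.\<close>

lemma tautological_form_smooth:
  assumes c: "c \<in> atlas P" and e: "e \<in> model P"
  shows "smooth_on (model P) (snd c ` fst c) (\<lambda>x. form1_in_chart P c \<theta> x e)"
  unfolding smooth_on_def
proof (intro allI Ck_on_local)
  show E: "subspace (model P)" and "openin (top_of_set (model P)) (snd c ` fst c)"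
    using atlas_P c by (auto simp: smooth_atlas_def)
  fix k x0 assume "x0 \<in> snd c ` fst c"
  then obtain p0 where p0: "p0 \<in> fst c" "x0 = snd c p0" by blast
  have PF: "pts P \<subseteq> frames M" and incl: "smooth_map P (frame_bundle M) (\<lambda>f. f)"
    using P by (auto simp: G_structure_def)
  have cP: "fst c \<subseteq> pts P" by (rule chart_subset_pts[OF atlas_P c])
  have inj: "inj_on (snd c) (fst c)" using atlas_P c by (simp add: smooth_atlas_def)
  define d where "d = chart_at M (fst p0)"
  have d: "d \<in> atlas M" "fst p0 \<in> fst d"
    using chart_at[OF atlas_M smooth_map_pts[OF smooth_proj, of p0]] p0 cP by (auto simp: d_def)
  define U where "U = snd c ` (fst c \<inter> (\<lambda>f. f) -` fst (frame_chart M d))"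
  define y where "y = snd d \<circ> fst \<circ> cinv c"
  define A where "A = (\<lambda>x. matrix (\<lambda>w. snd (cinv c x) w d))"
  have fc: "frame_chart M d \<in> atlas (frame_bundle M)"
    using d by (simp add: frame_bundle_def)
  have U: "openin (top_of_set (model P)) U"
    and F: "smooth_on (model P) U (snd (frame_chart M d) \<circ> (\<lambda>f. f) \<circ> cinv c)"
    using smooth_map_chart[OF incl c fc] by (auto simp: U_def)
  have F_eq: "(snd (frame_chart M d) \<circ> (\<lambda>f. f) \<circ> cinv c) = (\<lambda>x. (y x, A x))"
    by (auto simp: frame_chart_def y_def A_def)
  have A: "Ck_on k (model P) U A"
    using F Ck_on_linear[OF bounded_linear_snd, of k _ U "\<lambda>x. (y x, A x)"]
    unfolding F_eq smooth_on_def by simp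
  \<comment> \<open>One order more than for \<open>A\<close>, because the derivative of
    \<open>y\<close> enters the system.\<close>
  have "Ck_on (Suc k) (model P) U y"
    using F Ck_on_linear[OF bounded_linear_fst, of "Suc k" _ U "\<lambda>x. (y x, A x)"]
    unfolding F_eq smooth_on_def by (simp del: Ck_on.simps)
  then have b: "Ck_on k (model P) U (\<lambda>x. dir_deriv y x e)"
    using e unfolding Ck_on_Suc_iff[OF E U] by blast
  have pt: "A x *v form1_in_chart P c \<theta> x e = dir_deriv y x e" "invertible (A x)" if x: "x \<in> U" for x
  proof -
    obtain p where p: "p \<in> fst c" "fst p \<in> fst d" "x = snd c p"
      using x by (auto simp: U_def frame_chart_def)
    have cx: "cinv c x = p" using inj p by simp
    have pP: "p \<in> pts P" using p cP by blast
    have lin: "linear (\<lambda>w. snd p w d)"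
      by (rule linearI) (simp_all add: frame[OF pP] tangent_add_def tangent_scale_def)
    have Ax: "A x *v w = snd p w d" for w
      using matrix_works[OF lin[folded linear_matrix_vector_mul_eq]] by (simp add: A_def cx)
    define V where "V = tangent_of P c p e"
    have V: "V \<in> tangent_space P p" "V c = e"
      using tangent_of_in_tangent_space[OF atlas_P c p(1) e] tangent_of_self[OF atlas_P c p(1) e]
      by (auto simp: V_def)
    have "A x *v form1_in_chart P c \<theta> x e = tangent_map P M fst p V d"
      by (simp add: Ax form1_in_chart_def cx frame_tautological_form[OF pP V(1)] flip: V_def)
    also have "\<dots> = dir_deriv y x e"
      using tangent_map_in_charts[OF atlas_P smooth_proj c p(1) d(1) p(2) V(1)]
      by (simp add: y_def V(2) p(3))
    finally show "A x *v form1_in_chart P c \<theta> x e = dir_deriv y x e" .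
    \<comment> \<open>A tangent vector is determined by its component in a single chart, so
      injectivity of the frame passes to its matrix.\<close>
    have "inj ((*v) (A x))"
    proof (rule injI)
      fix w w' assume "A x *v w = A x *v w'"
      then have d_eq: "snd p w d = snd p w' d" by (simp add: Ax)
      have "snd p w = snd p w'"
        by (rule tangent_space_eqI[of "snd p w" M "fst p" "snd p w'" d]) 
           (use frame(3)[OF pP] d(1) p(2) d_eq in \<open>auto simp: bij_betw_def\<close>)
      then show "w = w'" using frame(3)[OF pP] by (auto simp: bij_betw_def inj_eq)
    qed
    then show "invertible (A x)"
      by (simp add: invertible_left_inverse matrix_left_invertible_injective)
  qed
  have "Ck_on k (model P) U (\<lambda>x. form1_in_chart P c \<theta> x e)"
    by (rule Ck_on_matrix_inv_mult[OF A b pt(2,1)])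
  moreover have "x0 \<in> U" "U \<subseteq> snd c ` fst c"
    using p0 d cP PF by (auto simp: U_def frame_chart_def)
  ultimately show "\<exists>U. openin (top_of_set (model P)) U \<and> x0 \<in> U \<and> U \<subseteq> snd c ` fst c \<and>
      Ck_on k (model P) U (\<lambda>x. form1_in_chart P c \<theta> x e)"
    using U by blast
qed

lemma Forms1_Pair_tautological_form:
  assumes "\<tau> \<in> Forms1 P W"
  shows "(\<lambda>p v. (\<tau> p v, \<theta> p v)) \<in> Forms1 P (W \<times> UNIV)"
proof -
  have "smooth_on (model P) (snd c ` fst c) (\<lambda>x. form1_in_chart P c (\<lambda>p v. (\<tau> p v, \<theta> p v)) x e)"
    if "c \<in> atlas P" "e \<in> model P" for c e
    using assms that tautological_form_smooth[OF that]
    by (auto simp: Forms1_def form1_in_chart_def smooth_on_def intro: Ck_on_Pair)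
  then show ?thesis
    using assms tautological_form_linear unfolding Forms1_def by auto
qed

text \<open>The component of the bracket in the Lie algebra is the commutator of the values of
  \<tau>; the other one is \<open>kbr\<close> of the values of \<theta> plus the mixed matrix terms.
  The factor 1/2 cancels the 2 in \<open>bracket_form\<close>, which leaves the structure equations
  with constant torsion and zero curvature.\<close>

lemma flat_imp_connection:
  assumes kbr: "almost_lie_bracket kbr" and flat: "sdp_flat G kbr M P"
  shows "\<exists>\<tau>. principal_connection G P \<tau> \<and> torsion_function M P \<tau> (\<lambda>p v w. - kbr v w) \<and>
    curvature_function G M P \<tau> (\<lambda>p v w. 0)"
proof -
  obtain \<eta> where lift: "sdp_lift G M P \<eta>" and mc: "\<And>p v w. p \<in> pts P \<Longrightarrow> v \<in> tangent_space P p \<Longrightarrow>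
      w \<in> tangent_space P p \<Longrightarrow> ext_deriv P \<eta> p v w + (1/2) *\<^sub>R bracket_form (sdp_bracket kbr) \<eta> p v w = 0"
    using flat unfolding sdp_flat_def by blast
  define \<tau> where "\<tau> = (\<lambda>p v. fst (\<eta> p v))"
  have \<eta>: "\<eta> \<in> Forms1 P (lie_algebra G \<times> UNIV)" "equivariant_form G P sdp_rep \<eta>"
    "\<And>\<alpha> p. \<alpha> \<in> lie_algebra G \<Longrightarrow> p \<in> pts P \<Longrightarrow> \<eta> p (fundamental_vector P \<alpha> p) = (\<alpha>, 0)"
    and \<theta>: "\<And>p v. p \<in> pts P \<Longrightarrow> v \<in> tangent_space P p \<Longrightarrow> \<theta> p v = snd (\<eta> p v)"
    using lift by (auto simp: sdp_lift_def)
  have "principal_connection G P \<tau>"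
    unfolding principal_connection_def
  proof (intro conjI ballI)
    show "\<tau> \<in> Forms1 P (lie_algebra G)"
      unfolding \<tau>_def by (rule Forms1_linear_image[OF bounded_linear_fst \<eta>(1)]) auto
    show "equivariant_form G P Ad \<tau>"
      using \<eta>(2) by (auto simp: equivariant_form_def \<tau>_def sdp_rep_def split_beta)
  qed (simp add: \<tau>_def \<eta>(3))
  moreover have "ext_deriv P \<tau> p v w = - mbracket (\<tau> p v) (\<tau> p w) \<and>
      ext_deriv P \<theta> p v w = - kbr (\<theta> p v) (\<theta> p w) - (\<tau> p v *v \<theta> p w - \<tau> p w *v \<theta> p v)"
    if p: "p \<in> pts P" and v: "v \<in> tangent_space P p" and w: "w \<in> tangent_space P p" for p v w
  proof -
    have "ext_deriv P \<tau> p v w = fst (ext_deriv P \<eta> p v w)"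
      by (rule ext_deriv_linear_image[OF atlas_P bounded_linear_fst \<eta>(1) _ p v w]) (simp add: \<tau>_def)
    moreover have "ext_deriv P \<theta> p v w = snd (ext_deriv P \<eta> p v w)"
      by (rule ext_deriv_linear_image[OF atlas_P bounded_linear_snd \<eta>(1) _ p v w]) (rule \<theta>)
    moreover have "ext_deriv P \<eta> p v w = - sdp_bracket kbr (\<eta> p v) (\<eta> p w)"
      using mc[OF p v w] by (simp add: bracket_form_def eq_neg_iff_add_eq_0)
    ultimately show ?thesis
      using \<theta> p v w by (simp add: sdp_bracket_def split_beta \<tau>_def)
  qed
  moreover have "(\<lambda>v w. - kbr v w) \<in> alternating_maps UNIV"
  proof -
    have bil: "bilinear kbr" and skew: "\<And>v w. kbr v w = - kbr w v"
      using kbr unfolding almost_lie_bracket_def by blast+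
    \<comment> \<open>\<open>alternating_maps\<close> asks for zero on the diagonal, which over the
      reals follows from skew-symmetry.\<close>
    have "kbr v v = 0" for v
    proof -
      have "kbr v v + kbr v v = 0"
        by (subst (1) skew) simp
      then show ?thesis by (simp flip: scaleR_2)
    qed
    then show ?thesis
      using bil by (auto simp: alternating_maps_def bilinear_def intro: linear_compose_neg)
  qed
  moreover have "(\<lambda>v w. 0) \<in> alternating_maps (lie_algebra G)"
    using zero_in_lie_algebra[OF G] by (auto simp: alternating_maps_def bilinear_def linear_zero)
  ultimately show ?thesis
    unfolding torsion_function_def curvature_function_def Let_def by auto
qed

lemma connection_imp_flat:
  assumes \<tau>: "principal_connection G P \<tau>"
    and T: "torsion_function M P \<tau> T" and R: "curvature_function G M P \<tau> R"
    and R0: "\<And>p v w. p \<in> pts P \<Longrightarrow> R p v w = 0"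
    and Tk: "\<And>p v w. p \<in> pts P \<Longrightarrow> T p v w = - kbr v w"
  shows "sdp_flat G kbr M P"
proof -
  define \<eta> where "\<eta> = (\<lambda>p v. (\<tau> p v, \<theta> p v))"
  have \<eta>: "\<eta> \<in> Forms1 P (lie_algebra G \<times> UNIV)"
    using \<tau> unfolding \<eta>_def principal_connection_def by (blast intro: Forms1_Pair_tautological_form)
  have "sdp_lift G M P \<eta>"
    unfolding sdp_lift_def
  proof (intro conjI ballI \<eta>)
    show "equivariant_form G P sdp_rep \<eta>"
      using \<tau> tautological_form_equivariant
      by (simp add: equivariant_form_def principal_connection_def \<eta>_def sdp_rep_def)
  qed (use \<tau> tautological_form_fundamental_vector in \<open>auto simp: \<eta>_def principal_connection_def\<close>)
  moreover have "ext_deriv P \<eta> p v w + (1/2) *\<^sub>R bracket_form (sdp_bracket kbr) \<eta> p v w = 0"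
    if p: "p \<in> pts P" and v: "v \<in> tangent_space P p" and w: "w \<in> tangent_space P p" for p v w
  proof -
    have "fst (ext_deriv P \<eta> p v w) = ext_deriv P \<tau> p v w"
      by (rule ext_deriv_linear_image[OF atlas_P bounded_linear_fst \<eta> _ p v w, symmetric]) (simp add: \<eta>_def)
    also have "\<dots> = - mbracket (\<tau> p v) (\<tau> p w)"
      using R p v w R0[OF p] by (simp add: curvature_function_def Let_def)
    finally have 1: "fst (ext_deriv P \<eta> p v w) = - mbracket (\<tau> p v) (\<tau> p w)" .
    have "snd (ext_deriv P \<eta> p v w) = ext_deriv P \<theta> p v w"
      by (rule ext_deriv_linear_image[OF atlas_P bounded_linear_snd \<eta> _ p v w, symmetric]) (simp add: \<eta>_def)
    also have "\<dots> = - kbr (\<theta> p v) (\<theta> p w) - (\<tau> p v *v \<theta> p w - \<tau> p w *v \<theta> p v)"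
      using T p v w Tk[OF p] by (simp add: torsion_function_def Let_def)
    finally show ?thesis
      using 1 by (simp add: prod_eq_iff bracket_form_def sdp_bracket_def \<eta>_def)
  qed
  ultimately show ?thesis
    unfolding sdp_flat_def by blast
qed

end

theorem theorem3p45:
  fixes G :: "(real^'n^'n, 'k::euclidean_space) mfd"
    and M :: "('m, real^'n) mfd"
    and P :: "(('m, 'n) frame, 'e::euclidean_space) mfd"
    and kbr :: "real^'n \<Rightarrow> real^'n \<Rightarrow> real^'n"
  assumes "lie_subgroup_GL G"
    and "smooth_manifold M" and "model M = UNIV"
    and "G_structure G M P"
    and "almost_lie_bracket kbr"
  shows "sdp_flat G kbr M P \<longleftrightarrow>
    (\<exists>\<tau> T R. principal_connection G P \<tau> \<and>
       torsion_function M P \<tau> T \<and> curvature_function G M P \<tau> R \<and>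
       (\<forall>p\<in>pts P. \<forall>v w. R p v w = 0) \<and>
       (\<forall>p\<in>pts P. \<forall>v w. T p v w = - kbr v w))"
proof -
  interpret G_struct G M P
    using assms by unfold_locales
  show ?thesis
  proof
    assume "sdp_flat G kbr M P"
    from flat_imp_connection[OF assms(5) this] obtain \<tau> where
      "principal_connection G P \<tau>" "torsion_function M P \<tau> (\<lambda>p v w. - kbr v w)"
      "curvature_function G M P \<tau> (\<lambda>p v w. 0)" by blast
    then show "\<exists>\<tau> T R. principal_connection G P \<tau> \<and>
       torsion_function M P \<tau> T \<and> curvature_function G M P \<tau> R \<and>
       (\<forall>p\<in>pts P. \<forall>v w. R p v w = 0) \<and> (\<forall>p\<in>pts P. \<forall>v w. T p v w = - kbr v w)"
      by (intro exI[of _ \<tau>] exI[of _ "\<lambda>p v w. - kbr v w"] exI[of _ "\<lambda>p v w. 0"]) auto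
  qed (use connection_imp_flat in blast)
qed

end
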